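(* Let $k\ge 2$ and let $\Omega\subset\{1,\dots,k\}^{\mathbb{Z}}$ be an aperiodic subshift endowed with an ergodic shift-invariant probability measure $\mu$ such that: (1) there exists an integer $K>0$ such that $\mu(\{\omega:\ \omega_0=\omega_1=\cdots=\omega_{K-1}\})=0$; (2) there exists an integer $L>0$ such that for any $1\le i\le k$ and any $\omega=(\omega_p)_{p\in\mathbb{Z}}\in\operatorname{supp}\mu$, there exists $0\le j\le L-1$ such that $\omega_j=i$. Then for any $0<\gamma<\frac14$ there exists a constant $C>0$ such that for any non-constant function $v:\{1,\dots,k\}\to\mathbb{R}$, denoting $\lambda=\min\{|v(i)-v(j)|:\ 1\le i<j\le k\}$, one has $\mathrm{Leb}(\Sigma_v)<C\lambda^{-\gamma}$ (with the right-hand side read as $+\infty$ when $\lambda=0$).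
   Context: A subshift $\Omega\subset\{1,\dots,k\}^{\mathbb{Z}}$ is a nonempty compact (product topology of discrete spaces) set invariant under the shift $T$, $(T\omega)_n=\omega_{n+1}$. It is aperiodic if it contains no $T$-periodic point. $\operatorname{supp}\mu$ is the topological support of $\mu$, and $\mathrm{Leb}$ is Lebesgue measure on $\mathbb{R}$. For $v:\{1,\dots,k\}\to\mathbb{R}$ and $\omega\in\Omega$, let $H_\omega$ be the operator on $\ell^2(\mathbb{Z})$ given by $(H_\omega u)_n=u_{n+1}+u_{n-1}+v(\omega_n)u_n$. By ergodicity, the spectrum of $H_\omega$ is the same set for $\mu$-almost every $\omega$; this almost sure spectrum is denoted $\Sigma_v$. *)

theory Defs
  imports "HOL-Probability.Probability"
begin

text \<open>Subshifts. The type \<^typ>\<open>int \<Rightarrow> nat\<close> carries the product topology of the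
  discrete topology on \<^typ>\<open>nat\<close>.\<close>

definition shift :: "(int \<Rightarrow> nat) \<Rightarrow> (int \<Rightarrow> nat)" where
  "shift \<omega> = (\<lambda>n. \<omega> (n + 1))"

definition subshift :: "nat \<Rightarrow> (int \<Rightarrow> nat) set \<Rightarrow> bool" where
  "subshift k \<Omega> \<longleftrightarrow> \<Omega> \<noteq> {} \<and> \<Omega> \<subseteq> UNIV \<rightarrow> {1..k} \<and> compact \<Omega> \<and> shift ` \<Omega> = \<Omega>"

definition aperiodic :: "(int \<Rightarrow> nat) set \<Rightarrow> bool" where
  "aperiodic \<Omega> \<longleftrightarrow> \<not> (\<exists>\<omega>\<in>\<Omega>. \<exists>p>0. (shift ^^ p) \<omega> = \<omega>)"

definition shift_invariant :: "(int \<Rightarrow> nat) measure \<Rightarrow> bool" where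
  "shift_invariant \<mu> \<longleftrightarrow> shift \<in> measurable \<mu> \<mu> \<and> distr \<mu> \<mu> shift = \<mu>"

definition shift_ergodic :: "(int \<Rightarrow> nat) measure \<Rightarrow> bool" where
  "shift_ergodic \<mu> \<longleftrightarrow>
     (\<forall>A\<in>sets \<mu>. shift -` A \<inter> space \<mu> = A \<longrightarrow> emeasure \<mu> A = 0 \<or> emeasure \<mu> A = 1)"

text \<open>Topological support, relative to the subspace topology of the space of the measure.\<close>

definition msupport :: "'a::topological_space measure \<Rightarrow> 'a set" where
  "msupport \<mu> = {x \<in> space \<mu>. \<forall>U. open U \<and> x \<in> U \<longrightarrow> emeasure \<mu> (U \<inter> space \<mu>) > 0}"

definition ell2 :: "(int \<Rightarrow> complex) set" where
  "ell2 = {u. (\<lambda>n. (cmod (u n))\<^sup>2) summable_on UNIV}"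

definition ell2_norm :: "(int \<Rightarrow> complex) \<Rightarrow> real" where
  "ell2_norm u = sqrt (\<Sum>\<^sub>\<infinity>n. (cmod (u n))\<^sup>2)"

text \<open>Operators are functions on all sequences, of which only the restriction to
  \<^const>\<open>ell2\<close> is considered.\<close>

definition bounded_op_ell2 :: "((int \<Rightarrow> complex) \<Rightarrow> (int \<Rightarrow> complex)) \<Rightarrow> bool" where
  "bounded_op_ell2 A \<longleftrightarrow>
     A \<in> ell2 \<rightarrow> ell2 \<and>
     (\<forall>u\<in>ell2. \<forall>w\<in>ell2. A (\<lambda>n. u n + w n) = (\<lambda>n. A u n + A w n)) \<and>
     (\<forall>u\<in>ell2. \<forall>c. A (\<lambda>n. c * u n) = (\<lambda>n. c * A u n)) \<and>
     (\<exists>M. \<forall>u\<in>ell2. ell2_norm (A u) \<le> M * ell2_norm u)"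

definition boundedly_invertible_ell2 :: "((int \<Rightarrow> complex) \<Rightarrow> (int \<Rightarrow> complex)) \<Rightarrow> bool" where
  "boundedly_invertible_ell2 A \<longleftrightarrow>
     A \<in> ell2 \<rightarrow> ell2 \<and>
     (\<exists>B. bounded_op_ell2 B \<and> (\<forall>u\<in>ell2. A (B u) = u \<and> B (A u) = u))"

definition spectrum_ell2 :: "((int \<Rightarrow> complex) \<Rightarrow> (int \<Rightarrow> complex)) \<Rightarrow> complex set" where
  "spectrum_ell2 A = {z. \<not> boundedly_invertible_ell2 (\<lambda>u n. A u n - z * u n)}"

definition schrodinger ::
  "(nat \<Rightarrow> real) \<Rightarrow> (int \<Rightarrow> nat) \<Rightarrow> (int \<Rightarrow> complex) \<Rightarrow> (int \<Rightarrow> complex)" where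
  "schrodinger v \<omega> u = (\<lambda>n. u (n + 1) + u (n - 1) + of_real (v (\<omega> n)) * u n)"

definition as_spectrum :: "(int \<Rightarrow> nat) measure \<Rightarrow> (nat \<Rightarrow> real) \<Rightarrow> complex set" where
  "as_spectrum \<mu> v = (THE S. AE \<omega> in \<mu>. spectrum_ell2 (schrodinger v \<omega>) = S)"

lemma as_spectrum_eqI:
  assumes "prob_space \<mu>" and S: "AE \<omega> in \<mu>. spectrum_ell2 (schrodinger v \<omega>) = S"
  shows "as_spectrum \<mu> v = S"
  unfolding as_spectrum_def
proof (rule the_equality)
  interpret prob_space \<mu> by fact
  show "AE \<omega> in \<mu>. spectrum_ell2 (schrodinger v \<omega>) = S" by fact
  fix S' assume "AE \<omega> in \<mu>. spectrum_ell2 (schrodinger v \<omega>) = S'"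
  with S have "AE \<omega> in \<mu>. S' = S" by eventually_elim simp
  then show "S' = S" by simp
qed

definition min_gap :: "nat \<Rightarrow> (nat \<Rightarrow> real) \<Rightarrow> real" where
  "min_gap k v = Min {\<bar>v i - v j\<bar> | i j. 1 \<le> i \<and> i < j \<and> j \<le> k}"

end

theory Submission
  imports Defs
begin

text \<open>
  Write \<open>\<Delta>\<close> for the minimal gap between the values of \<open>v\<close>. When \<open>\<Delta>\<close> is large, every site whose
  letter differs from \<open>i\<close> is a potential barrier of relative height about \<open>\<Delta>\<close> for energies within 2 of
  \<open>v i\<close>. By the first hypothesis on \<open>\<mu>\<close>, almost every \<open>\<omega>\<close> has runs of equal letters of bounded length,
  so for such energies the operator is, up to a perturbation of size \<open>1 / \<Delta>\<close>, a direct sum of free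
  Dirichlet Laplacians on blocks of bounded length, shifted by \<open>v i\<close>. The eigenvalues of the
  Laplacian on \<open>m\<close> sites are \<open>2 * cos (\<pi> j / (m + 1))\<close>, so the spectrum lies within \<open>O(1 / \<Delta>)\<close> of a
  finite set whose cardinality depends only on \<open>k\<close> and the run length. Hence its measure is
  \<open>O(1 / \<Delta>)\<close>, which for \<open>\<Delta> \<ge> 1\<close> is at most a constant times \<open>\<Delta> powr (- \<gamma>)\<close>. For bounded \<open>\<Delta>\<close> it
  suffices that the spectrum lies in the \<open>k\<close> intervals of length 4 centred at the values of \<open>v\<close>.

  The perturbative step is quantitative and elementary. It uses the characterization
  \<open>jacobi_invertible_iff_bounded_below\<close> of the resolvent set, so that only lower bounds on
  \<open>(H - x) u\<close> are needed. On the barriers, \<open>u\<close> is controlled by \<open>1 / \<Delta>\<close> times its neighbours; inside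
  a run, Green's identity against \<open>\<lambda>l. sin (l \<theta>)\<close>, where the energy is \<open>v i + 2 * cos \<theta>\<close>, controls \<open>u\<close>
  by its values on the two adjacent barriers at the price of a factor \<open>1 / \<bar>sin ((m + 1) \<theta>)\<bar>\<close>
  (\<open>near_level_bounded_below\<close>). The combination is a lower bound unless one of these sines is
  \<open>O(1 / \<Delta>)\<close>.

  The almost sure spectrum is defined by a description, so one also has to know that it exists. Being
  bounded below can be tested on finitely supported vectors, so the spectrum depends only on the set
  of finite words that occur in \<open>\<omega>\<close>, and that set is almost surely constant by ergodicity. It
  follows that a single typical \<open>\<omega>\<close> represents the almost sure spectra of all \<open>v\<close> at once
  (\<open>as_spectrum_realized\<close>).
\<close>

section \<open>Square-summable sequences\<close>

text \<open>Membership and norm are read off from finite sections, where the triangle inequality for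
  \<^const>\<open>L2_set\<close> is available.\<close>

lemma ell2I:
  assumes "\<And>F. finite F \<Longrightarrow> L2_set (\<lambda>n. cmod (u n)) F \<le> C"
  shows "u \<in> ell2" and "ell2_norm u \<le> C"
proof -
  have C: "C \<ge> 0" using assms[of "{}"] by simp
  have fin: "(\<Sum>n\<in>F. (cmod (u n))\<^sup>2) \<le> C\<^sup>2" if "finite F" for F
    using assms[OF that] C by (simp add: L2_set_def real_sqrt_le_iff' sum_nonneg real_le_lsqrt sqrt_le_D)
  have summ: "(\<lambda>n. (cmod (u n))\<^sup>2) summable_on UNIV"
    by (rule nonneg_bdd_above_summable_on) (auto intro!: bdd_aboveI[of _ "C\<^sup>2"] fin)
  then show "u \<in> ell2" by (simp add: ell2_def)
  have "(\<Sum>\<^sub>\<infinity>n. (cmod (u n))\<^sup>2) \<le> C\<^sup>2"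
    by (rule infsum_le_finite_sums[OF summ]) (auto intro: fin)
  then show "ell2_norm u \<le> C"
    unfolding ell2_norm_def using C by (simp add: real_le_lsqrt)
qed

lemma L2_set_le_ell2_norm:
  assumes "u \<in> ell2" "finite F"
  shows "L2_set (\<lambda>n. cmod (u n)) F \<le> ell2_norm u"
  unfolding L2_set_def ell2_norm_def
  using assms by (intro real_sqrt_le_mono finite_sum_le_infsum) (auto simp: ell2_def)

lemma ell2_norm_nonneg: "ell2_norm u \<ge> 0"
  unfolding ell2_norm_def by (intro real_sqrt_ge_zero infsum_nonneg) auto

lemma cmod_le_ell2_norm: "u \<in> ell2 \<Longrightarrow> cmod (u n) \<le> ell2_norm u"
  using L2_set_le_ell2_norm[of u "{n}"] by simp

lemma ell2_dominated:
  assumes "w \<in> ell2" "\<And>n. cmod (u n) \<le> cmod (w n)"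
  shows "u \<in> ell2" "ell2_norm u \<le> ell2_norm w"
proof -
  have "L2_set (\<lambda>n. cmod (u n)) F \<le> ell2_norm w" if "finite F" for F
    using L2_set_mono[of F "\<lambda>n. cmod (u n)" "\<lambda>n. cmod (w n)"]
      L2_set_le_ell2_norm[OF assms(1) that] assms(2) by fastforce
  from ell2I[OF this] show "u \<in> ell2" "ell2_norm u \<le> ell2_norm w" by auto
qed

lemma ell2_add:
  assumes "u \<in> ell2" "w \<in> ell2"
  shows "(\<lambda>n. u n + w n) \<in> ell2" "ell2_norm (\<lambda>n. u n + w n) \<le> ell2_norm u + ell2_norm w"
proof -
  have "L2_set (\<lambda>n. cmod (u n + w n)) F \<le> ell2_norm u + ell2_norm w" if "finite F" for F
  proof -
    have "L2_set (\<lambda>n. cmod (u n + w n)) F \<le> L2_set (\<lambda>n. cmod (u n) + cmod (w n)) F"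
      by (rule L2_set_mono) (auto intro: norm_triangle_ineq)
    also have "\<dots> \<le> L2_set (\<lambda>n. cmod (u n)) F + L2_set (\<lambda>n. cmod (w n)) F"
      by (rule L2_set_triangle_ineq)
    finally show ?thesis
      using L2_set_le_ell2_norm[OF assms(1) that] L2_set_le_ell2_norm[OF assms(2) that] by linarith
  qed
  from ell2I[OF this] show "(\<lambda>n. u n + w n) \<in> ell2"
    "ell2_norm (\<lambda>n. u n + w n) \<le> ell2_norm u + ell2_norm w" by auto
qed

lemma ell2_bounded_mult:
  assumes "u \<in> ell2" "\<And>n. cmod (q n) \<le> M"
  shows "(\<lambda>n. q n * u n) \<in> ell2" "ell2_norm (\<lambda>n. q n * u n) \<le> M * ell2_norm u"
proof -
  have M: "M \<ge> 0" using assms(2)[of 0] norm_ge_zero order_trans by blast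
  have "L2_set (\<lambda>n. cmod (q n * u n)) F \<le> M * ell2_norm u" if "finite F" for F
  proof -
    have "L2_set (\<lambda>n. cmod (q n * u n)) F \<le> L2_set (\<lambda>n. M * cmod (u n)) F"
      by (rule L2_set_mono) (auto simp: norm_mult intro: mult_right_mono assms)
    also have "\<dots> = M * L2_set (\<lambda>n. cmod (u n)) F"
      using M by (simp add: L2_set_right_distrib)
    finally show ?thesis
      using mult_left_mono[OF L2_set_le_ell2_norm[OF assms(1) that] M] by linarith
  qed
  from ell2I[OF this] show "(\<lambda>n. q n * u n) \<in> ell2"
    "ell2_norm (\<lambda>n. q n * u n) \<le> M * ell2_norm u" by auto
qed

lemma ell2_cmult:
  assumes "u \<in> ell2"
  shows "(\<lambda>n. c * u n) \<in> ell2" "ell2_norm (\<lambda>n. c * u n) \<le> cmod c * ell2_norm u"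
  using ell2_bounded_mult[OF assms, of "\<lambda>_. c" "cmod c"] by auto

lemma ell2_dominated_scaled:
  assumes "w \<in> ell2" "c > 0" "\<And>n. c * cmod (u n) \<le> cmod (w n)"
  shows "u \<in> ell2" "c * ell2_norm u \<le> ell2_norm w"
proof -
  have bd: "cmod (u n) \<le> cmod (of_real (1 / c) * w n)" for n
    using assms(2,3) by (simp add: norm_mult norm_divide field_simps)
  note dom = ell2_dominated[OF ell2_cmult(1)[OF assms(1)] bd]
  show "u \<in> ell2" by (rule dom)
  have "ell2_norm u \<le> cmod (of_real (1 / c)) * ell2_norm w"
    using dom(2) ell2_cmult(2)[OF assms(1), of "of_real (1 / c)"] by linarith
  then show "c * ell2_norm u \<le> ell2_norm w"
    using assms(2) by (simp add: norm_divide field_simps)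
qed

lemma ell2_uminus:
  assumes "u \<in> ell2"
  shows "(\<lambda>n. - u n) \<in> ell2" "ell2_norm (\<lambda>n. - u n) \<le> ell2_norm u"
  using ell2_dominated[OF assms, of "\<lambda>n. - u n"] by auto

lemma ell2_diff:
  assumes "u \<in> ell2" "w \<in> ell2"
  shows "(\<lambda>n. u n - w n) \<in> ell2" "ell2_norm (\<lambda>n. u n - w n) \<le> ell2_norm u + ell2_norm w"
  using ell2_add[OF assms(1) ell2_uminus(1)[OF assms(2)]] ell2_uminus(2)[OF assms(2)] by auto

lemma ell2_shift:
  assumes "u \<in> ell2"
  shows "(\<lambda>n. u (n + s)) \<in> ell2" "ell2_norm (\<lambda>n. u (n + s)) \<le> ell2_norm u"
proof -
  have "L2_set (\<lambda>n. cmod (u (n + s))) F \<le> ell2_norm u" if "finite F" for F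
  proof -
    have "L2_set (\<lambda>n. cmod (u (n + s))) F = L2_set (\<lambda>n. cmod (u n)) ((\<lambda>n. n + s) ` F)"
      unfolding L2_set_def by (subst sum.reindex) (auto simp: inj_on_def)
    then show ?thesis using L2_set_le_ell2_norm[OF assms finite_imageI[OF that]] by simp
  qed
  from ell2I[OF this] show "(\<lambda>n. u (n + s)) \<in> ell2" "ell2_norm (\<lambda>n. u (n + s)) \<le> ell2_norm u" by auto
qed

lemma ell2_sum:
  assumes "finite I" "\<And>i. i \<in> I \<Longrightarrow> u i \<in> ell2" "\<And>i. i \<in> I \<Longrightarrow> ell2_norm (u i) \<le> C i"
  shows "(\<lambda>n. \<Sum>i\<in>I. u i n) \<in> ell2 \<and> ell2_norm (\<lambda>n. \<Sum>i\<in>I. u i n) \<le> (\<Sum>i\<in>I. C i)"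
  using assms
proof (induction I rule: finite_induct)
  case empty
  show ?case using ell2I[of "\<lambda>_. 0" 0] by (simp add: L2_set_def)
next
  case (insert i I)
  then have IH: "(\<lambda>n. \<Sum>i\<in>I. u i n) \<in> ell2" "ell2_norm (\<lambda>n. \<Sum>i\<in>I. u i n) \<le> (\<Sum>i\<in>I. C i)"
    by auto
  show ?case using ell2_add[OF insert.prems(1)[of i] IH(1)] insert IH(2)
    by (fastforce intro: order_trans)
qed

lemma ell2_cmod:
  assumes "u \<in> ell2"
  shows "(\<lambda>n. complex_of_real (cmod (u n))) \<in> ell2"
    "ell2_norm (\<lambda>n. complex_of_real (cmod (u n))) \<le> ell2_norm u"
  using ell2_dominated[OF assms, of "\<lambda>n. complex_of_real (cmod (u n))"] by auto

lemma ell2_finite_support: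
  assumes "finite F" "\<And>n. n \<notin> F \<Longrightarrow> u n = 0"
  shows "u \<in> ell2"
proof (rule ell2I)
  fix G :: "int set" assume G: "finite G"
  have "L2_set (\<lambda>n. cmod (u n)) G \<le> L2_set (\<lambda>n. cmod (u n)) (F \<union> G)"
    unfolding L2_set_def by (intro real_sqrt_le_mono sum_mono2) (use assms G in auto)
  also have "\<dots> = L2_set (\<lambda>n. cmod (u n)) F"
    unfolding L2_set_def using assms G 
    by (intro arg_cong[where f=sqrt] sum.mono_neutral_right) auto
  finally show "L2_set (\<lambda>n. cmod (u n)) G \<le> L2_set (\<lambda>n. cmod (u n)) F" .
qed

text \<open>Fatou's lemma for counting measure. It makes the norm lower semicontinuous under pointwise
  convergence, which replaces weak convergence below.\<close>

lemma ell2_fatou: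
  assumes "\<And>j. x j \<in> ell2" "\<And>j. ell2_norm (x j) \<le> c j" "c \<longlonglongrightarrow> C"
    and lim: "\<And>n. (\<lambda>j. x j n) \<longlonglongrightarrow> y n"
  shows "y \<in> ell2" "ell2_norm y \<le> C"
proof -
  have "L2_set (\<lambda>n. cmod (y n)) F \<le> C" if "finite F" for F
  proof (rule LIMSEQ_le[OF _ \<open>c \<longlonglongrightarrow> C\<close>])
    show "(\<lambda>j. L2_set (\<lambda>n. cmod (x j n)) F) \<longlonglongrightarrow> L2_set (\<lambda>n. cmod (y n)) F"
      unfolding L2_set_def by (intro tendsto_intros lim)
    show "\<exists>N. \<forall>j\<ge>N. L2_set (\<lambda>n. cmod (x j n)) F \<le> c j"
      using L2_set_le_ell2_norm[OF assms(1) that] assms(2) order_trans by blast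
  qed
  from ell2I[OF this] show "y \<in> ell2" "ell2_norm y \<le> C" by auto
qed

text \<open>Tychonoff, combined with metrizability of a countable product.\<close>

lemma pointwise_convergent_subsequence:
  fixes x :: "nat \<Rightarrow> int \<Rightarrow> complex"
  assumes "\<And>j n. cmod (x j n) \<le> B"
  obtains r y where "strict_mono (r :: nat \<Rightarrow> nat)" "\<And>n. (\<lambda>j. x (r j) n) \<longlonglongrightarrow> y n"
proof -
  let ?S = "Pi\<^sub>E UNIV (\<lambda>_::int. cball (0::complex) B)"
  have "compactin (product_topology (\<lambda>_::int. euclidean) UNIV) ?S"
    by (subst compactin_PiE) auto
  then have "compact ?S" by (metis compactin_euclidean_iff euclidean_product_topology)
  then have "seq_compact ?S" by (rule compact_imp_seq_compact)
  moreover have "\<forall>j. x j \<in> ?S" using assms by (auto simp: PiE_def)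
  ultimately obtain y r where r: "strict_mono (r :: nat \<Rightarrow> nat)" "(x \<circ> r) \<longlonglongrightarrow> y"
    by (meson seq_compactE)
  have "(\<lambda>j. x (r j) n) \<longlonglongrightarrow> y n" for n
  proof -
    have "continuous_on UNIV (\<lambda>f :: int \<Rightarrow> complex. f n)" by simp
    from continuous_on_tendsto_compose[OF this r(2)] show ?thesis by (simp add: o_def)
  qed
  with r that show ?thesis by blast
qed

lemma ell2_norm_sq: "u \<in> ell2 \<Longrightarrow> (ell2_norm u)\<^sup>2 = (\<Sum>\<^sub>\<infinity>n. (cmod (u n))\<^sup>2)"
  unfolding ell2_norm_def by (simp add: infsum_nonneg)

text \<open>First variation: if \<open>g\<close> has least norm on the complex line through it in direction \<open>s\<close>, then
  \<open>g\<close> is orthogonal to \<open>s\<close>. As \<open>s\<close> has finite support, the inner product is a finite sum and the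
  two norms differ by a finite sum.\<close>

lemma orthogonal_if_norm_minimal:
  assumes g: "g \<in> ell2" and F: "finite F" "\<And>n. n \<notin> F \<Longrightarrow> s n = 0"
    and min: "\<And>t. ell2_norm g \<le> ell2_norm (\<lambda>n. g n + t * s n)"
  shows "(\<Sum>n\<in>F. cnj (s n) * g n) = 0"
proof -
  define c where "c = (\<Sum>n\<in>F. cnj (s n) * g n)"
  define \<sigma> where "\<sigma> = (\<Sum>n\<in>F. (cmod (s n))\<^sup>2)"
  define \<tau> where "\<tau> = 1 / (\<sigma> + 1)"
  have \<sigma>: "\<sigma> \<ge> 0" unfolding \<sigma>_def by (intro sum_nonneg) auto
  then have \<tau>: "\<tau> > 0" "\<tau> * \<sigma> < 1" unfolding \<tau>_def by (auto simp: field_simps)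
  \<comment> \<open>a step against \<open>c\<close>, short enough for the linear term to dominate\<close>
  define t where "t = - of_real \<tau> * c"
  define w where "w = (\<lambda>n. g n + t * s n)"
  have s: "s \<in> ell2" using ell2_finite_support[OF F] .
  have w: "w \<in> ell2" unfolding w_def using ell2_add(1)[OF g ell2_cmult(1)[OF s]] .
  have summ: "(\<lambda>n. (cmod (w n))\<^sup>2) summable_on UNIV" "(\<lambda>n. (cmod (g n))\<^sup>2) summable_on UNIV"
    using w g by (auto simp: ell2_def)
  have "(ell2_norm g)\<^sup>2 \<le> (ell2_norm w)\<^sup>2"
    using min[of t] ell2_norm_nonneg[of g] unfolding w_def by (intro power_mono) auto
  then have "0 \<le> (\<Sum>\<^sub>\<infinity>n. (cmod (w n))\<^sup>2) - (\<Sum>\<^sub>\<infinity>n. (cmod (g n))\<^sup>2)"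
    using ell2_norm_sq[OF w] ell2_norm_sq[OF g] by simp
  also have "\<dots> = (\<Sum>\<^sub>\<infinity>n. (cmod (w n))\<^sup>2 - (cmod (g n))\<^sup>2)"
  proof -
    have "(\<lambda>n. (cmod (w n))\<^sup>2 - (cmod (g n))\<^sup>2) summable_on UNIV"
      using summable_on_add[OF summ(1), of "\<lambda>n. - (cmod (g n))\<^sup>2"] summ(2)
      by (simp add: summable_on_uminus)
    from infsum_add[OF this summ(2)] show ?thesis by simp
  qed
  also have "\<dots> = (\<Sum>\<^sub>\<infinity>n\<in>F. (cmod (w n))\<^sup>2 - (cmod (g n))\<^sup>2)"
    by (rule infsum_cong_neutral) (auto simp: w_def F)
  also have "\<dots> = (\<Sum>n\<in>F. (cmod (w n))\<^sup>2 - (cmod (g n))\<^sup>2)"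
    using F by simp
  also have "\<dots> = (\<Sum>n\<in>F. 2 * Re (cnj t * (cnj (s n) * g n)) + (cmod t)\<^sup>2 * (cmod (s n))\<^sup>2)"
  proof (rule sum.cong[OF refl])
    fix n
    show "(cmod (w n))\<^sup>2 - (cmod (g n))\<^sup>2 =
      2 * Re (cnj t * (cnj (s n) * g n)) + (cmod t)\<^sup>2 * (cmod (s n))\<^sup>2"
      unfolding w_def cmod_power2 by (simp add: power2_eq_square algebra_simps)
  qed
  also have "\<dots> = 2 * Re (cnj t * c) + (cmod t)\<^sup>2 * \<sigma>"
    unfolding c_def \<sigma>_def by (simp add: sum.distrib sum_distrib_left Re_sum)
  also have "Re (cnj t * c) = - \<tau> * (cmod c)\<^sup>2"
    unfolding t_def by (simp add: cmod_power2) (simp add: power2_eq_square algebra_simps)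
  also have "(cmod t)\<^sup>2 = \<tau>\<^sup>2 * (cmod c)\<^sup>2"
    unfolding t_def by (simp add: norm_mult power_mult_distrib)
  also have "2 * (- \<tau> * (cmod c)\<^sup>2) + \<tau>\<^sup>2 * (cmod c)\<^sup>2 * \<sigma> = - (\<tau> * (2 - \<tau> * \<sigma>)) * (cmod c)\<^sup>2"
    by (simp add: power2_eq_square algebra_simps)
  finally have "\<tau> * (2 - \<tau> * \<sigma>) * (cmod c)\<^sup>2 \<le> 0" by simp
  moreover have "\<tau> * (2 - \<tau> * \<sigma>) > 0" using \<tau> by simp
  ultimately have "(cmod c)\<^sup>2 \<le> 0" by (meson linorder_not_le mult_pos_pos)
  then show ?thesis by (simp add: c_def)
qed

section \<open>Invertibility of Jacobi operators\<close>

definition jacobi :: "(int \<Rightarrow> complex) \<Rightarrow> (int \<Rightarrow> complex) \<Rightarrow> int \<Rightarrow> complex" where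
  "jacobi q u = (\<lambda>n. u (n + 1) + u (n - 1) + q n * u n)"

lemma jacobi_add: "jacobi q (\<lambda>n. u n + w n) = (\<lambda>n. jacobi q u n + jacobi q w n)"
  and jacobi_diff: "jacobi q (\<lambda>n. u n - w n) = (\<lambda>n. jacobi q u n - jacobi q w n)"
  and jacobi_cmult: "jacobi q (\<lambda>n. c * u n) = (\<lambda>n. c * jacobi q u n)"
  by (auto simp: jacobi_def algebra_simps)

lemma jacobi_bounded:
  assumes q: "\<And>n. cmod (q n) \<le> M" and u: "u \<in> ell2"
  shows "jacobi q u \<in> ell2" "ell2_norm (jacobi q u) \<le> (2 + M) * ell2_norm u"
proof -
  note 1 = ell2_shift[OF u, of 1] and 2 = ell2_shift[OF u, of "- 1"] and 3 = ell2_bounded_mult[where q=q, OF u q]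
  note 4 = ell2_add[OF 1(1) 2(1)]
  note 5 = ell2_add[OF 4(1) 3(1)]
  show "jacobi q u \<in> ell2" using 5(1) by (simp add: jacobi_def)
  show "ell2_norm (jacobi q u) \<le> (2 + M) * ell2_norm u"
    using 1(2) 2(2) 3(2) 4(2) 5(2) by (simp add: jacobi_def algebra_simps)
qed

definition bounded_below :: "((int \<Rightarrow> complex) \<Rightarrow> (int \<Rightarrow> complex)) \<Rightarrow> bool" where
  "bounded_below A \<longleftrightarrow> (\<exists>\<epsilon>>0. \<forall>u\<in>ell2. \<epsilon> * ell2_norm u \<le> ell2_norm (A u))"

lemma ell2_norm_eq_0D: "u \<in> ell2 \<Longrightarrow> ell2_norm u \<le> 0 \<Longrightarrow> u = (\<lambda>_. 0)"
  using cmod_le_ell2_norm[of u] by (intro ext) (metis norm_le_zero_iff order_trans)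

text \<open>The adjoint of \<open>jacobi q\<close> is its conjugate by complex conjugation, an isometry.\<close>

lemma jacobi_adjoint_bounded_below:
  assumes "bounded_below (jacobi q)"
  shows "bounded_below (jacobi (\<lambda>n. cnj (q n)))"
proof -
  have n: "ell2_norm (\<lambda>n. cnj (u n)) = ell2_norm u" for u
    by (simp add: ell2_norm_def)
  have e: "u \<in> ell2 \<Longrightarrow> (\<lambda>n. cnj (u n)) \<in> ell2" for u
    by (simp add: ell2_def)
  have j: "jacobi (\<lambda>n. cnj (q n)) u = (\<lambda>n. cnj (jacobi q (\<lambda>n. cnj (u n)) n))" for u
    by (simp add: jacobi_def)
  from assms obtain \<epsilon> where "\<epsilon> > 0" "\<forall>u\<in>ell2. \<epsilon> * ell2_norm u \<le> ell2_norm (jacobi q u)"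
    unfolding bounded_below_def by auto
  then have "\<epsilon> * ell2_norm u \<le> ell2_norm (jacobi (\<lambda>n. cnj (q n)) u)" if "u \<in> ell2" for u
    using e[OF that] n[of u] unfolding j[of u] n[of "jacobi q (\<lambda>n. cnj (u n))"] by metis
  with \<open>\<epsilon> > 0\<close> show ?thesis unfolding bounded_below_def by blast
qed

text \<open>A minimizing sequence of \<open>\<parallel>jacobi q w - f\<parallel>\<close> is bounded because the operator is bounded below.
  A pointwise limit of a subsequence is a minimizer, because the operator acts locally and the norm is lower
  semicontinuous.\<close>

lemma jacobi_least_squares:
  assumes q: "\<And>n. cmod (q n) \<le> M" and bb: "bounded_below (jacobi q)" and f: "f \<in> ell2"
  obtains u where "u \<in> ell2"
    "\<And>w. w \<in> ell2 \<Longrightarrow> ell2_norm (\<lambda>n. jacobi q u n - f n) \<le> ell2_norm (\<lambda>n. jacobi q w n - f n)"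
proof -
  define R where "R u = ell2_norm (\<lambda>n. jacobi q u n - f n)" for u
  define m where "m = (INF w\<in>ell2. R w)"
  have bdd: "bdd_below (R ` ell2)"
    by (auto intro!: bdd_belowI[of _ 0] simp: R_def ell2_norm_nonneg)
  have m_le: "m \<le> R w" if "w \<in> ell2" for w
    unfolding m_def using bdd that by (rule cINF_lower)
  obtain \<epsilon> where \<epsilon>: "\<epsilon> > 0" "\<And>u. u \<in> ell2 \<Longrightarrow> \<epsilon> * ell2_norm u \<le> ell2_norm (jacobi q u)"
    using bb unfolding bounded_below_def by auto
  have "\<exists>w. w \<in> ell2 \<and> R w < m + 1 / real (Suc j)" for j
  proof -
    have "ell2 \<noteq> {}" using f by auto
    moreover have "(INF w\<in>ell2. R w) < m + 1 / real (Suc j)" unfolding m_def by simp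
    ultimately show ?thesis using cINF_less_iff[OF _ bdd] by blast
  qed
  then obtain x where x: "\<And>j. x j \<in> ell2" "\<And>j. R (x j) < m + 1 / real (Suc j)" by metis
  note J = jacobi_bounded[where q=q, OF q]
  define B where "B = (m + 1 + ell2_norm f) / \<epsilon>"
  have xB: "ell2_norm (x j) \<le> B" for j
  proof -
    have r: "(\<lambda>n. jacobi q (x j) n - f n) \<in> ell2" using ell2_diff(1)[OF J(1)[OF x(1)] f] .
    have "ell2_norm (jacobi q (x j)) \<le> R (x j) + ell2_norm f"
      using ell2_add(2)[OF r f] by (simp add: R_def)
    moreover have "1 / real (Suc j) \<le> 1" by simp
    ultimately have "\<epsilon> * ell2_norm (x j) \<le> m + 1 + ell2_norm f"
      using \<epsilon>(2)[OF x(1)[of j]] x(2)[of j] by linarith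
    then show ?thesis unfolding B_def using \<epsilon>(1) by (simp add: field_simps)
  qed
  have "cmod (x j n) \<le> B" for j n
    using cmod_le_ell2_norm[OF x(1), of j n] xB[of j] by linarith
  then obtain r u where r: "strict_mono (r :: nat \<Rightarrow> nat)" and u: "\<And>n. (\<lambda>j. x (r j) n) \<longlonglongrightarrow> u n"
    using pointwise_convergent_subsequence by blast
  have u2: "u \<in> ell2"
    by (rule ell2_fatou(1)[of "\<lambda>j. x (r j)" "\<lambda>_. B" B]) (auto simp: x xB u)
  have "ell2_norm (\<lambda>n. jacobi q u n - f n) \<le> m"
  proof (rule ell2_fatou(2))
    show "(\<lambda>n. jacobi q (x (r j)) n - f n) \<in> ell2" for j
      using ell2_diff(1)[OF J(1)[OF x(1)] f] .
    show "ell2_norm (\<lambda>n. jacobi q (x (r j)) n - f n) \<le> m + 1 / real (Suc (r j))" for j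
      using x(2)[of "r j"] by (simp add: R_def)
    have "(\<lambda>j. m + 1 / real (Suc j)) \<longlonglongrightarrow> m + 0"
      by (intro tendsto_intros LIMSEQ_Suc[OF lim_1_over_n])
    from LIMSEQ_subseq_LIMSEQ[OF this r] show "(\<lambda>j. m + 1 / real (Suc (r j))) \<longlonglongrightarrow> m"
      by (simp add: o_def)
    show "(\<lambda>j. jacobi q (x (r j)) n - f n) \<longlonglongrightarrow> jacobi q u n - f n" for n
      unfolding jacobi_def by (intro tendsto_intros u)
  qed
  with m_le that[OF u2] show ?thesis unfolding R_def by force
qed

text \<open>The residual \<open>g\<close> of a least-squares solution is orthogonal to the images of all unit vectors,
  so the adjoint annihilates it. The adjoint is bounded below too, so the residual is zero.\<close>

lemma jacobi_surj:
  assumes q: "\<And>n. cmod (q n) \<le> M" and bb: "bounded_below (jacobi q)" and f: "f \<in> ell2"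
  shows "\<exists>u\<in>ell2. jacobi q u = f"
proof -
  note J = jacobi_bounded[where q=q, OF q]
  obtain u where u: "u \<in> ell2"
    "\<And>w. w \<in> ell2 \<Longrightarrow> ell2_norm (\<lambda>n. jacobi q u n - f n) \<le> ell2_norm (\<lambda>n. jacobi q w n - f n)"
    using jacobi_least_squares[where q=q, OF q bb f] by blast
  define g where "g = (\<lambda>n. jacobi q u n - f n)"
  have g: "g \<in> ell2" unfolding g_def using ell2_diff(1)[OF J(1)[OF u(1)] f] .
  have "jacobi (\<lambda>n. cnj (q n)) g k = 0" for k
  proof -
    define d where "d = (\<lambda>n::int. if n = k then 1 else (0::complex))"
    define s where "s = jacobi q d"
    have d: "d \<in> ell2" by (rule ell2_finite_support[of "{k}"]) (auto simp: d_def)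
    have "(\<Sum>n\<in>{k - 1, k, k + 1}. cnj (s n) * g n) = 0"
    proof (rule orthogonal_if_norm_minimal[OF g])
      show "s n = 0" if "n \<notin> {k - 1, k, k + 1}" for n
        using that by (auto simp: s_def jacobi_def d_def)
      fix t
      have "(\<lambda>n. u n + t * d n) \<in> ell2" using ell2_add(1)[OF u(1) ell2_cmult(1)[OF d]] .
      from u(2)[OF this] show "ell2_norm g \<le> ell2_norm (\<lambda>n. g n + t * s n)"
        by (simp add: g_def s_def jacobi_add jacobi_cmult algebra_simps)
    qed simp
    then show ?thesis by (simp add: s_def jacobi_def d_def algebra_simps)
  qed
  then have "jacobi (\<lambda>n. cnj (q n)) g = (\<lambda>_. 0)" by auto
  moreover obtain \<epsilon> where "\<epsilon> > 0" "\<And>u. u \<in> ell2 \<Longrightarrow> \<epsilon> * ell2_norm u \<le> ell2_norm (jacobi (\<lambda>n. cnj (q n)) u)"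
    using jacobi_adjoint_bounded_below[OF bb] unfolding bounded_below_def by auto
  moreover have "ell2_norm (\<lambda>_. 0) = 0" by (simp add: ell2_norm_def)
  ultimately have "\<epsilon> * ell2_norm g \<le> 0" using g by fastforce
  then have "g = (\<lambda>_. 0)" using \<open>\<epsilon> > 0\<close> g by (intro ell2_norm_eq_0D) (auto simp: mult_le_0_iff)
  then have "jacobi q u = f" by (auto simp: g_def fun_eq_iff)
  with u(1) show ?thesis by blast
qed

theorem jacobi_invertible_iff_bounded_below:
  assumes q: "\<And>n. cmod (q n) \<le> M"
  shows "boundedly_invertible_ell2 (jacobi q) \<longleftrightarrow> bounded_below (jacobi q)"
proof
  assume "boundedly_invertible_ell2 (jacobi q)"
  then obtain B N where B: "\<And>u. u \<in> ell2 \<Longrightarrow> B (jacobi q u) = u"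
    and N: "\<And>u. u \<in> ell2 \<Longrightarrow> ell2_norm (B u) \<le> N * ell2_norm u"
    unfolding boundedly_invertible_ell2_def bounded_op_ell2_def by metis
  have "(1 / (\<bar>N\<bar> + 1)) * ell2_norm u \<le> ell2_norm (jacobi q u)" if u: "u \<in> ell2" for u
  proof -
    have "ell2_norm u \<le> N * ell2_norm (jacobi q u)"
      using N[OF jacobi_bounded(1)[where q=q, OF q u]] B[OF u] by simp
    also have "\<dots> \<le> (\<bar>N\<bar> + 1) * ell2_norm (jacobi q u)"
      by (intro mult_right_mono ell2_norm_nonneg) auto
    finally show ?thesis by (simp add: field_simps)
  qed
  then show "bounded_below (jacobi q)"
    unfolding bounded_below_def by (intro exI[of _ "1 / (\<bar>N\<bar> + 1)"]) auto
next
  assume bb: "bounded_below (jacobi q)"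
  then obtain \<epsilon> where \<epsilon>: "\<epsilon> > 0" "\<And>u. u \<in> ell2 \<Longrightarrow> \<epsilon> * ell2_norm u \<le> ell2_norm (jacobi q u)"
    unfolding bounded_below_def by auto
  have inj: "u = w" if "u \<in> ell2" "w \<in> ell2" "jacobi q u = jacobi q w" for u w
  proof -
    have "jacobi q (\<lambda>n. u n - w n) = (\<lambda>_. 0)" using that(3) by (simp add: jacobi_diff)
    moreover have "ell2_norm (\<lambda>_. 0) = 0" by (simp add: ell2_norm_def)
    ultimately have "\<epsilon> * ell2_norm (\<lambda>n. u n - w n) \<le> 0"
      using \<epsilon>(2)[OF ell2_diff(1)[OF that(1,2)]] by simp
    then have "(\<lambda>n. u n - w n) = (\<lambda>_. 0)"
      using \<epsilon>(1) by (intro ell2_norm_eq_0D ell2_diff(1)[OF that(1,2)]) (auto simp: mult_le_0_iff)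
    then show ?thesis by (auto simp: fun_eq_iff)
  qed
  define B where "B f = (SOME u. u \<in> ell2 \<and> jacobi q u = f)" for f
  have B: "B f \<in> ell2" "jacobi q (B f) = f" if "f \<in> ell2" for f
    using someI_ex[of "\<lambda>u. u \<in> ell2 \<and> jacobi q u = f"] jacobi_surj[where q=q, OF q bb that]
    by (auto simp: B_def)
  have BJ: "B (jacobi q u) = u" if "u \<in> ell2" for u
    using that jacobi_bounded(1)[where q=q, OF q that] by (intro inj[of "B (jacobi q u)" u] B) auto
  show "boundedly_invertible_ell2 (jacobi q)"
    unfolding boundedly_invertible_ell2_def bounded_op_ell2_def
  proof (intro conjI exI[of _ B] ballI allI)
    show "jacobi q \<in> ell2 \<rightarrow> ell2" using jacobi_bounded(1)[where q=q, OF q] by auto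
    show "B \<in> ell2 \<rightarrow> ell2" using B by auto
    show "B (\<lambda>n. u n + w n) = (\<lambda>n. B u n + B w n)" if "u \<in> ell2" "w \<in> ell2" for u w
      using that by (rule_tac inj) (simp_all add: B jacobi_add ell2_add)
    show "B (\<lambda>n. c * u n) = (\<lambda>n. c * B u n)" if "u \<in> ell2" for u c
      using that by (rule_tac inj) (simp_all add: B jacobi_cmult ell2_cmult)
    show "\<exists>M. \<forall>u\<in>ell2. ell2_norm (B u) \<le> M * ell2_norm u"
    proof (intro exI[of _ "1 / \<epsilon>"] ballI)
      fix u assume "u \<in> ell2"
      then show "ell2_norm (B u) \<le> 1 / \<epsilon> * ell2_norm u"
        using \<epsilon>(2)[OF B(1)[of u]] B(2)[of u] \<epsilon>(1) by (simp add: field_simps)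
    qed
    show "jacobi q (B u) = u" "B (jacobi q u) = u" if "u \<in> ell2" for u
      using that B BJ by auto
  qed
qed

lemma ell2_tail:
  assumes u: "u \<in> ell2" and e: "e > 0"
  shows "\<exists>N::nat. ell2_norm (\<lambda>n. if \<bar>n\<bar> \<le> int N then 0 else u n) \<le> e"
proof -
  have "((\<lambda>n. (cmod (u n))\<^sup>2) has_sum (ell2_norm u)\<^sup>2) UNIV"
    using u ell2_norm_sq[OF u] by (simp add: ell2_def)
  then have lim: "(sum (\<lambda>n. (cmod (u n))\<^sup>2) \<longlongrightarrow> (ell2_norm u)\<^sup>2) (finite_subsets_at_top UNIV)"
    by (simp add: has_sum_def)
  have "eventually (\<lambda>F. (ell2_norm u)\<^sup>2 - e\<^sup>2 < (\<Sum>n\<in>F. (cmod (u n))\<^sup>2)) (finite_subsets_at_top UNIV)"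
    by (rule order_tendstoD(1)[OF lim]) (use e in simp)
  then obtain F where F: "finite F" "\<And>G. finite G \<Longrightarrow> F \<subseteq> G \<Longrightarrow> (ell2_norm u)\<^sup>2 - e\<^sup>2 < (\<Sum>n\<in>G. (cmod (u n))\<^sup>2)"
    by (auto simp: eventually_finite_subsets_at_top)
  define N where "N = nat (\<Sum>n\<in>F. \<bar>n\<bar>)"
  have FN: "\<bar>n\<bar> \<le> int N" if "n \<in> F" for n
  proof -
    have "\<bar>n\<bar> \<le> (\<Sum>n\<in>F. \<bar>n\<bar>)" using F(1) that by (intro member_le_sum) auto
    then show ?thesis by (simp add: N_def)
  qed
  have "ell2_norm (\<lambda>n. if \<bar>n\<bar> \<le> int N then 0 else u n) \<le> e"
  proof (rule ell2I(2))
    fix G :: "int set" assume G: "finite G"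
    define G' where "G' = {n\<in>G. \<not> \<bar>n\<bar> \<le> int N}"
    have fin: "finite G'" "finite {- int N..int N}" "G' \<inter> {- int N..int N} = {}"
      using G by (auto simp: G'_def)
    have "(\<Sum>n\<in>G. (cmod (if \<bar>n\<bar> \<le> int N then 0 else u n))\<^sup>2) = (\<Sum>n\<in>G'. (cmod (u n))\<^sup>2)"
      unfolding G'_def using G by (subst sum.inter_filter) (auto intro!: sum.cong)
    moreover have "(ell2_norm u)\<^sup>2 - e\<^sup>2 < (\<Sum>n\<in>{- int N..int N}. (cmod (u n))\<^sup>2)"
      by (rule F) (use FN in fastforce)+
    moreover have "(\<Sum>n\<in>G' \<union> {- int N..int N}. (cmod (u n))\<^sup>2) \<le> (ell2_norm u)\<^sup>2"
      unfolding ell2_norm_sq[OF u] using fin u by (intro finite_sum_le_infsum) (auto simp: ell2_def)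
    moreover have "(\<Sum>n\<in>G' \<union> {- int N..int N}. (cmod (u n))\<^sup>2)
        = (\<Sum>n\<in>G'. (cmod (u n))\<^sup>2) + (\<Sum>n\<in>{- int N..int N}. (cmod (u n))\<^sup>2)"
      using fin by (intro sum.union_disjoint) auto
    ultimately have "(\<Sum>n\<in>G. (cmod (if \<bar>n\<bar> \<le> int N then 0 else u n))\<^sup>2) \<le> e\<^sup>2" by linarith
    then show "L2_set (\<lambda>n. cmod (if \<bar>n\<bar> \<le> int N then 0 else u n)) G \<le> e"
      unfolding L2_set_def using e by (intro real_le_lsqrt) (auto intro: sum_nonneg)
  qed
  then show ?thesis by blast
qed

text \<open>Truncation converges in norm, and the operator is bounded, so a lower bound passes from
  finitely supported vectors to all of them with the same constant.\<close>

lemma jacobi_bounded_below_from_finite_support: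
  assumes q: "\<And>n. cmod (q n) \<le> M" and \<epsilon>: "\<epsilon> \<ge> 0"
    and fin: "\<And>u N. (\<And>n. \<bar>n\<bar> > int N \<Longrightarrow> u n = 0) \<Longrightarrow> \<epsilon> * ell2_norm u \<le> ell2_norm (jacobi q u)"
    and u: "u \<in> ell2"
  shows "\<epsilon> * ell2_norm u \<le> ell2_norm (jacobi q u)"
proof (rule field_le_epsilon)
  fix e :: real assume e: "e > 0"
  have M: "M \<ge> 0" using q[of 0] norm_ge_zero order_trans by blast
  define \<eta> where "\<eta> = e / (\<epsilon> + 2 + M)"
  have \<eta>: "\<eta> > 0" unfolding \<eta>_def using e \<epsilon> M by simp
  obtain N where N: "ell2_norm (\<lambda>n. if \<bar>n\<bar> \<le> int N then 0 else u n) \<le> \<eta>"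
    using ell2_tail[OF u \<eta>] by blast
  define w where "w = (\<lambda>n. if \<bar>n\<bar> \<le> int N then 0 else u n)"
  define c where "c = (\<lambda>n. if \<bar>n\<bar> \<le> int N then u n else 0)"
  have w: "w \<in> ell2" and c: "c \<in> ell2"
    using ell2_dominated(1)[OF u, of w] ell2_dominated(1)[OF u, of c] by (auto simp: w_def c_def)
  note J = jacobi_bounded[where q=q, OF q]
  have "ell2_norm u \<le> ell2_norm c + ell2_norm w"
  proof -
    have "(\<lambda>n. c n + w n) = u" by (auto simp: c_def w_def)
    with ell2_add(2)[OF c w] show ?thesis by simp
  qed
  then have "\<epsilon> * ell2_norm u \<le> \<epsilon> * ell2_norm c + \<epsilon> * ell2_norm w"
    using \<epsilon> by (metis distrib_left mult_left_mono)
  moreover have "\<epsilon> * ell2_norm c \<le> ell2_norm (jacobi q c)"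
    by (rule fin[of N]) (auto simp: c_def)
  moreover have "ell2_norm (jacobi q c) \<le> ell2_norm (jacobi q u) + ell2_norm (jacobi q w)"
  proof -
    have "c = (\<lambda>n. u n - w n)" by (auto simp: c_def w_def)
    then have "jacobi q c = (\<lambda>n. jacobi q u n - jacobi q w n)" by (simp add: jacobi_diff)
    with ell2_diff(2)[OF J(1)[OF u] J(1)[OF w]] show ?thesis by simp
  qed
  moreover have "ell2_norm (jacobi q w) \<le> (2 + M) * ell2_norm w" by (rule J(2)[OF w])
  moreover have "(\<epsilon> + 2 + M) * ell2_norm w \<le> (\<epsilon> + 2 + M) * \<eta>"
    using N \<epsilon> M by (intro mult_left_mono) (auto simp: w_def)
  moreover have "(\<epsilon> + 2 + M) * \<eta> = e" using \<epsilon> M by (simp add: \<eta>_def)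
  moreover have "(\<epsilon> + 2 + M) * ell2_norm w = \<epsilon> * ell2_norm w + (2 + M) * ell2_norm w"
    by (simp add: algebra_simps)
  ultimately show "\<epsilon> * ell2_norm u \<le> ell2_norm (jacobi q u) + e"
    by linarith
qed

section \<open>The spectrum is determined by the words that occur\<close>

text \<open>Positions range over all integers, which makes this invariant under the shift.\<close>

definition occurs :: "nat list \<Rightarrow> (int \<Rightarrow> nat) \<Rightarrow> bool" where
  "occurs w \<omega> \<longleftrightarrow> (\<exists>s. \<forall>j<length w. \<omega> (s + int j) = w ! j)"

text \<open>A vector supported in \<open>[-N, N]\<close> meets only the word \<open>\<omega>' (-N), \<dots>, \<omega>' N\<close>. That word also occurs
  in \<open>\<omega>\<close>, so translating the vector to an occurrence gives the same norms.\<close>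

lemma bounded_below_transfer:
  assumes occ: "\<And>w. occurs w \<omega>' \<Longrightarrow> occurs w \<omega>"
    and p: "\<And>n. cmod (p (\<omega>' n)) \<le> M"
    and bb: "bounded_below (jacobi (\<lambda>n. p (\<omega> n)))"
  shows "bounded_below (jacobi (\<lambda>n. p (\<omega>' n)))"
proof -
  define q where "q = (\<lambda>n. p (\<omega> n))"
  define q' where "q' = (\<lambda>n. p (\<omega>' n))"
  have q': "\<And>n. cmod (q' n) \<le> M" using p by (simp add: q'_def)
  obtain \<epsilon> where \<epsilon>: "\<epsilon> > 0" "\<And>u. u \<in> ell2 \<Longrightarrow> \<epsilon> * ell2_norm u \<le> ell2_norm (jacobi q u)"
    using bb unfolding bounded_below_def q_def by auto
  have "\<epsilon> * ell2_norm u \<le> ell2_norm (jacobi q' u)"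
    if supp: "\<And>n. \<bar>n\<bar> > int N \<Longrightarrow> u n = 0" for u N
  proof -
    have u: "u \<in> ell2" by (rule ell2_finite_support[of "{- int N..int N}"]) (auto intro!: supp)
    define w where "w = map (\<lambda>j. \<omega>' (int j - int N)) [0..<2 * N + 1]"
    have "occurs w \<omega>'" unfolding occurs_def
      by (intro exI[of _ "- int N"]) (auto simp: w_def simp del: upt_Suc)
    then obtain s where s: "\<And>j. j < 2 * N + 1 \<Longrightarrow> \<omega> (s + int j) = \<omega>' (int j - int N)"
      using occ[of w] unfolding occurs_def by (auto simp: w_def simp del: upt_Suc)
    define t where "t = s + int N"
    have t: "\<omega> (m + t) = \<omega>' m" if "\<bar>m\<bar> \<le> int N" for m
    proof -
      have "nat (m + int N) < 2 * N + 1" "int (nat (m + int N)) = m + int N" using that by auto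
      from s[OF this(1)] this(2) show ?thesis by (simp add: t_def algebra_simps)
    qed
    define u' where "u' = (\<lambda>n. u (n - t))"
    have u': "u' \<in> ell2" using ell2_shift(1)[OF u, of "- t"] by (simp add: u'_def)
    have Ju: "jacobi q' u \<in> ell2" by (rule jacobi_bounded(1)[where q = q', OF q' u])
    have "jacobi q u' = (\<lambda>n. jacobi q' u (n - t))"
    proof
      fix n
      show "jacobi q u' n = jacobi q' u (n - t)"
        using t[of "n - t"] supp[of "n - t"]
        by (cases "\<bar>n - t\<bar> \<le> int N") (auto simp: jacobi_def u'_def q_def q'_def algebra_simps)
    qed
    then have "ell2_norm (jacobi q u') \<le> ell2_norm (jacobi q' u)"
      using ell2_shift(2)[OF Ju, of "- t"] by simp
    moreover have "ell2_norm u \<le> ell2_norm u'"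
      using ell2_shift(2)[OF u', of t] by (simp add: u'_def)
    then have "\<epsilon> * ell2_norm u \<le> \<epsilon> * ell2_norm u'" using \<epsilon>(1) by simp
    ultimately show ?thesis using \<epsilon>(2)[OF u'] by linarith
  qed
  then have "\<forall>u\<in>ell2. \<epsilon> * ell2_norm u \<le> ell2_norm (jacobi q' u)"
    using jacobi_bounded_below_from_finite_support[where q = q', OF q' less_imp_le[OF \<epsilon>(1)]] by blast
  then show ?thesis using \<epsilon>(1) unfolding bounded_below_def q'_def by blast
qed

lemma potential_bounded:
  assumes "\<And>n. \<omega> n \<in> {1..k::nat}"
  shows "cmod (complex_of_real (v (\<omega> n)) - z) \<le> (\<Sum>i=1..k. \<bar>v i\<bar>) + cmod z"
proof -
  have "\<bar>v (\<omega> n)\<bar> \<le> (\<Sum>i=1..k. \<bar>v i\<bar>)"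
    by (rule member_le_sum[of "\<omega> n" "{1..k}" "\<lambda>i. \<bar>v i\<bar>"]) (use assms in auto)
  then show ?thesis using norm_triangle_ineq4[of "complex_of_real (v (\<omega> n))" z] by simp
qed

lemma schrodinger_spectrum_iff:
  assumes "\<And>n. \<omega> n \<in> {1..k::nat}"
  shows "z \<in> spectrum_ell2 (schrodinger v \<omega>) \<longleftrightarrow>
    \<not> bounded_below (jacobi (\<lambda>n. complex_of_real (v (\<omega> n)) - z))"
proof -
  have "(\<lambda>u n. schrodinger v \<omega> u n - z * u n) = jacobi (\<lambda>n. complex_of_real (v (\<omega> n)) - z)"
    by (auto simp: schrodinger_def jacobi_def fun_eq_iff algebra_simps)
  then show ?thesis
    unfolding spectrum_ell2_def
    using jacobi_invertible_iff_bounded_below[where q = "\<lambda>n. complex_of_real (v (\<omega> n)) - z",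
      OF potential_bounded[where \<omega> = \<omega> and k = k, OF assms]] by simp
qed

lemma spectrum_determined_by_words:
  assumes "\<And>n. \<omega> n \<in> {1..k::nat}" "\<And>n. \<omega>' n \<in> {1..k}" "\<And>w. occurs w \<omega> \<longleftrightarrow> occurs w \<omega>'"
  shows "spectrum_ell2 (schrodinger v \<omega>) = spectrum_ell2 (schrodinger v \<omega>')"
proof (intro set_eqI)
  fix z
  note M = potential_bounded[where \<omega> = \<omega> and k = k and v = v and z = z, OF assms(1)]
    and M' = potential_bounded[where \<omega> = \<omega>' and k = k and v = v and z = z, OF assms(2)]
  have "bounded_below (jacobi (\<lambda>n. complex_of_real (v (\<omega> n)) - z)) \<longleftrightarrow>
    bounded_below (jacobi (\<lambda>n. complex_of_real (v (\<omega>' n)) - z))"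
    using bounded_below_transfer[where \<omega> = \<omega> and \<omega>' = \<omega>' and p = "\<lambda>a. complex_of_real (v a) - z", OF _ M']
      bounded_below_transfer[where \<omega> = \<omega>' and \<omega>' = \<omega> and p = "\<lambda>a. complex_of_real (v a) - z", OF _ M]
      assms(3) by auto
  then show "z \<in> spectrum_ell2 (schrodinger v \<omega>) \<longleftrightarrow> z \<in> spectrum_ell2 (schrodinger v \<omega>')"
    unfolding schrodinger_spectrum_iff[where \<omega> = \<omega> and k = k, OF assms(1)]
      schrodinger_spectrum_iff[where \<omega> = \<omega>' and k = k, OF assms(2)] by simp
qed

lemma coordinate_measurable:
  assumes "sets \<mu> = sets (restrict_space borel \<Omega>)"
  shows "(\<lambda>\<omega> :: int \<Rightarrow> nat. \<omega> n) \<in> measurable \<mu> (count_space UNIV)"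
proof -
  have "(\<lambda>\<omega> :: int \<Rightarrow> nat. \<omega> n) \<in> measurable borel (count_space UNIV)"
  proof (subst measurable_count_space_eq2_countable, safe)
    fix i :: nat
    have "open ((\<lambda>\<omega> :: int \<Rightarrow> nat. \<omega> n) -` {i})"
      by (rule open_vimage) (simp_all add: discrete_topology_class.open_discrete)
    then show "(\<lambda>\<omega>. \<omega> n) -` {i} \<inter> space borel \<in> sets (borel :: (int \<Rightarrow> nat) measure)" by simp
  qed auto
  then have "(\<lambda>\<omega> :: int \<Rightarrow> nat. \<omega> n) \<in> measurable (restrict_space borel \<Omega>) (count_space UNIV)"
    by (rule measurable_restrict_space1)
  then show ?thesis using measurable_cong_sets[OF assms refl] by blast
qed

text \<open>The event that a given word occurs is exactly shift-invariant, since occurrences are counted at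
  all integer positions. So it has probability zero or one, and there are countably many words.\<close>

lemma AE_same_words:
  assumes "subshift k \<Omega>" "sets \<mu> = sets (restrict_space borel \<Omega>)" "prob_space \<mu>" "shift_ergodic \<mu>"
  shows "\<exists>W. AE \<omega> in \<mu>. \<forall>w. occurs w \<omega> \<longleftrightarrow> w \<in> W"
proof -
  interpret prob_space \<mu> by fact
  note [measurable] = coordinate_measurable[OF assms(2)]
  have sp: "space \<mu> = \<Omega>" using sets_eq_imp_space_eq[OF assms(2)] by (simp add: space_restrict_space)
  define E where "E w = {\<omega> \<in> space \<mu>. occurs w \<omega>}" for w
  have E: "E w \<in> sets \<mu>" for w
    unfolding E_def occurs_def by measurable
  have occ_shift: "occurs w (shift \<omega>) \<longleftrightarrow> occurs w \<omega>" for w \<omega>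
  proof
    assume "occurs w (shift \<omega>)"
    then obtain s where "\<forall>j<length w. \<omega> (s + int j + 1) = w ! j" by (auto simp: occurs_def shift_def)
    then show "occurs w \<omega>" unfolding occurs_def by (intro exI[of _ "s + 1"]) (auto simp: algebra_simps)
  next
    assume "occurs w \<omega>"
    then obtain s where "\<forall>j<length w. \<omega> (s + int j) = w ! j" by (auto simp: occurs_def)
    then show "occurs w (shift \<omega>)" unfolding occurs_def shift_def by (intro exI[of _ "s - 1"]) auto
  qed
  have "shift \<omega> \<in> \<Omega>" if "\<omega> \<in> \<Omega>" for \<omega>
    using assms(1) that by (auto simp: subshift_def)
  then have inv: "shift -` E w \<inter> space \<mu> = E w" for w
    by (auto simp: E_def occ_shift sp)
  have zero_one: "emeasure \<mu> (E w) = 0 \<or> emeasure \<mu> (E w) = 1" for w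
    using assms(4)[unfolded shift_ergodic_def, rule_format, OF E inv] .
  have "AE \<omega> in \<mu>. occurs w \<omega> \<longleftrightarrow> w \<in> {w. emeasure \<mu> (E w) = 1}" for w
  proof (cases "emeasure \<mu> (E w) = 1")
    case True
    then have "prob (E w) = 1" by (simp add: measure_def)
    then have "AE \<omega> in \<mu>. \<omega> \<in> E w" using prob_eq_1[OF E] by simp
    then show ?thesis by (rule AE_mp) (use True in \<open>auto simp: E_def\<close>)
  next
    case False
    then have "emeasure \<mu> (E w) = 0" using zero_one by blast
    then have "AE \<omega> in \<mu>. \<not> occurs w \<omega>"
      using E by (auto intro!: AE_I[of _ _ "E w"] simp: E_def)
    then show ?thesis by (rule AE_mp) (use False in auto)
  qed
  then show ?thesis by (intro exI[of _ "{w. emeasure \<mu> (E w) = 1}"]) (simp add: AE_all_countable)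
qed

text \<open>The hypothesis at position 0 moves to every integer position: the events at \<open>m\<close> and \<open>m + 1\<close>
  are related by a preimage under the shift, so they have equal measure.\<close>

lemma AE_no_long_runs:
  assumes "subshift k \<Omega>" "sets \<mu> = sets (restrict_space borel \<Omega>)" "shift_invariant \<mu>"
    and K: "emeasure \<mu> {\<omega> \<in> \<Omega>. \<forall>n<K. \<omega> (int n) = \<omega> 0} = 0"
  shows "AE \<omega> in \<mu>. \<forall>m. \<exists>n<K. \<omega> (m + int n) \<noteq> \<omega> m"
proof -
  note [measurable] = coordinate_measurable[OF assms(2)]
  have sp: "space \<mu> = \<Omega>" using sets_eq_imp_space_eq[OF assms(2)] by (simp add: space_restrict_space)
  define E where "E m = {\<omega> \<in> space \<mu>. \<forall>n<K. \<omega> (m + int n) = \<omega> m}" for m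
  have E: "E m \<in> sets \<mu>" for m
    unfolding E_def by measurable
  have sh: "shift \<in> measurable \<mu> \<mu>" "distr \<mu> \<mu> shift = \<mu>"
    using assms(3) by (auto simp: shift_invariant_def)
  have "shift \<omega> \<in> \<Omega>" if "\<omega> \<in> \<Omega>" for \<omega>
    using assms(1) that by (auto simp: subshift_def)
  then have "shift -` E m \<inter> space \<mu> = E (m + 1)" for m
    by (auto simp: E_def sp shift_def algebra_simps)
  then have step: "emeasure \<mu> (E (m + 1)) = emeasure \<mu> (E m)" for m
    using emeasure_distr[OF sh(1) E, of m] sh(2) by simp
  have "emeasure \<mu> (E m) = 0" for m
  proof (induction m rule: int_induct[of _ 0])
    case base
    show ?case using K by (simp add: E_def sp)
  next
    case (step1 i) then show ?case by (simp add: step)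
  next
    case (step2 i) then show ?case using step[of "i - 1"] by simp
  qed
  then have "AE \<omega> in \<mu>. \<exists>n<K. \<omega> (m + int n) \<noteq> \<omega> m" for m
    using E[of m] by (intro AE_I[of _ _ "E m"]) (auto simp: E_def)
  then show ?thesis by (simp add: AE_all_countable)
qed

text \<open>One sequence serves all \<open>v\<close>, because the almost sure set of words does not depend on \<open>v\<close>.\<close>

lemma as_spectrum_realized:
  assumes "subshift k \<Omega>" "sets \<mu> = sets (restrict_space borel \<Omega>)" "prob_space \<mu>"
    "shift_invariant \<mu>" "shift_ergodic \<mu>"
    and K: "emeasure \<mu> {\<omega> \<in> \<Omega>. \<forall>n<K. \<omega> (int n) = \<omega> 0} = 0"
  obtains \<omega>\<^sub>0 where "\<And>n. \<omega>\<^sub>0 n \<in> {1..k}" "\<And>m. \<exists>n<K. \<omega>\<^sub>0 (m + int n) \<noteq> \<omega>\<^sub>0 m"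
    "\<And>v. as_spectrum \<mu> v = spectrum_ell2 (schrodinger v \<omega>\<^sub>0)"
proof -
  interpret prob_space \<mu> by fact
  have sp: "space \<mu> = \<Omega>" using sets_eq_imp_space_eq[OF assms(2)] by (simp add: space_restrict_space)
  have range: "\<omega> n \<in> {1..k}" if "\<omega> \<in> space \<mu>" for \<omega> n
    using assms(1) that unfolding sp subshift_def by blast
  obtain W where W: "AE \<omega> in \<mu>. \<forall>w. occurs w \<omega> \<longleftrightarrow> w \<in> W"
    using AE_same_words[OF assms(1,2,3,5)] by blast
  have runs: "AE \<omega> in \<mu>. \<forall>m. \<exists>n<K. \<omega> (m + int n) \<noteq> \<omega> m"
    by (rule AE_no_long_runs[OF assms(1,2,4) K])
  have "AE \<omega> in \<mu>. \<omega> \<in> space \<mu> \<and> (\<forall>w. occurs w \<omega> \<longleftrightarrow> w \<in> W) \<and> (\<forall>m. \<exists>n<K. \<omega> (m + int n) \<noteq> \<omega> m)"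
    using W runs AE_space by eventually_elim blast
  from eventually_happens'[OF ae_filter_bot this] obtain \<omega>\<^sub>0 where \<omega>\<^sub>0: "\<omega>\<^sub>0 \<in> space \<mu>" "\<And>w. occurs w \<omega>\<^sub>0 \<longleftrightarrow> w \<in> W"
    "\<And>m. \<exists>n<K. \<omega>\<^sub>0 (m + int n) \<noteq> \<omega>\<^sub>0 m"
    by blast
  have "as_spectrum \<mu> v = spectrum_ell2 (schrodinger v \<omega>\<^sub>0)" for v
  proof (rule as_spectrum_eqI)
    show "AE \<omega> in \<mu>. spectrum_ell2 (schrodinger v \<omega>) = spectrum_ell2 (schrodinger v \<omega>\<^sub>0)"
      using W AE_space
    proof eventually_elim
      case (elim \<omega>)
      then show ?case
        by (intro spectrum_determined_by_words[where k = k] range \<omega>\<^sub>0(1)) (simp_all add: \<omega>\<^sub>0(2))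
    qed
  qed fact
  with that \<omega>\<^sub>0 range show ?thesis by blast
qed

section \<open>Energies near a level\<close>

text \<open>Green's identity on \<open>[a, a + m + 1]\<close> for \<open>u\<close> and the solution \<open>sin (l \<theta>)\<close> of the free equation at
  energy \<open>2 * cos \<theta>\<close>. This solution vanishes at \<open>a\<close>, so \<open>u (a + 1)\<close> does not enter.\<close>

lemma sine_green_identity:
  fixes u :: "int \<Rightarrow> complex" and \<theta> :: real
  defines "S \<equiv> \<lambda>l::nat. complex_of_real (sin (real l * \<theta>))"
  shows "S (m + 1) * u (a + int m) = S m * u (a + int m + 1) + S 1 * u a
    - (\<Sum>l=1..m. S l * (u (a + int l + 1) + u (a + int l - 1) - of_real (2 * cos \<theta>) * u (a + int l)))"
proof (induction m)
  case 0
  show ?case by (simp add: S_def)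
next
  case (Suc m)
  have "sin (real (m + 2) * \<theta>) = 2 * cos \<theta> * sin (real (m + 1) * \<theta>) - sin (real m * \<theta>)"
    using sin_add[of "real (m + 1) * \<theta>" \<theta>] sin_diff[of "real (m + 1) * \<theta>" \<theta>]
    by (simp add: algebra_simps)
  then have rec: "S (m + 2) = of_real (2 * cos \<theta>) * S (m + 1) - S m"
    unfolding S_def by (simp flip: of_real_mult of_real_diff)
  define T where "T = (\<Sum>l=1..m. S l * (u (a + int l + 1) + u (a + int l - 1) - of_real (2 * cos \<theta>) * u (a + int l)))"
  have "S m * u (a + int m + 1) + S 1 * u a - T = S (m + 1) * u (a + int m)"
    using Suc.IH by (simp add: T_def)
  then have T: "T = S m * u (a + int m + 1) + S 1 * u a - S (Suc m) * u (a + int m)"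
    by (simp add: algebra_simps)
  have sum: "(\<Sum>l=1..Suc m. S l * (u (a + int l + 1) + u (a + int l - 1) - of_real (2 * cos \<theta>) * u (a + int l)))
    = T + S (Suc m) * (u (a + int m + 2) + u (a + int m) - of_real (2 * cos \<theta>) * u (a + int m + 1))"
    by (simp add: T_def algebra_simps)
  have index: "a + int (Suc m) = a + int m + 1" "a + int m + 1 + 1 = a + int m + 2" "Suc m + 1 = m + 2"
    by simp_all
  show ?case
    unfolding sum index rec T by (simp add: algebra_simps)
qed

text \<open>The identity bounds \<open>u\<close> at the last site of the run. The equation is then solved for
  \<open>u (n - 1)\<close>, moving left; each step costs at most a factor 4, namely 2 for the coefficient
  \<open>2 * cos \<theta>\<close> and 1 each for \<open>u (n + 1)\<close> and the right-hand side. The factor is harmless because runs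
  are short.\<close>

lemma run_bound:
  fixes u f :: "int \<Rightarrow> complex" and \<theta> \<delta> X :: real
  assumes eq: "\<And>l. l \<in> {1..m} \<Longrightarrow> f (a + int l) =
      u (a + int l + 1) + u (a + int l - 1) - of_real (2 * cos \<theta>) * u (a + int l)"
    and \<delta>: "0 < \<delta>" "\<delta> \<le> 1" "\<delta> \<le> \<bar>sin (real (m + 1) * \<theta>)\<bar>"
    and X: "cmod (u a) + cmod (u (a + int m + 1)) + (\<Sum>l=1..m. cmod (f (a + int l))) \<le> X"
    and j: "j \<le> m"
  shows "cmod (u (a + int m - int j)) \<le> 4 ^ j * X / \<delta>"
proof -
  have X0: "X \<ge> 0"
    by (rule order_trans[OF _ X]) (auto intro!: add_nonneg_nonneg sum_nonneg)
  have b: "cmod (u (a + int m + 1)) \<le> X / \<delta>"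
  proof -
    have "0 \<le> (\<Sum>l=1..m. cmod (f (a + int l)))" by (auto intro: sum_nonneg)
    then have "cmod (u (a + int m + 1)) \<le> X"
      using X norm_ge_zero[of "u a"] by linarith
    also have "X \<le> X / \<delta>" using \<delta> X0 by (simp add: field_simps mult_left_le)
    finally show ?thesis .
  qed
  have fX: "cmod (f (a + int l)) \<le> X / \<delta>" if "l \<in> {1..m}" for l
  proof -
    have "cmod (f (a + int l)) \<le> (\<Sum>l=1..m. cmod (f (a + int l)))"
      using that by (intro member_le_sum[of l "{1..m}" "\<lambda>l. cmod (f (a + int l))"]) auto
    then have "cmod (f (a + int l)) \<le> X"
      using X norm_ge_zero[of "u a"] norm_ge_zero[of "u (a + int m + 1)"] by linarith
    also have "X \<le> X / \<delta>" using \<delta> X0 by (simp add: field_simps mult_left_le)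
    finally show ?thesis .
  qed
  have last: "cmod (u (a + int m)) \<le> X / \<delta>"
  proof -
    define S where "S = (\<lambda>l::nat. complex_of_real (sin (real l * \<theta>)))"
    have S1: "cmod (S l * z) \<le> cmod z" for l z
      by (simp add: S_def norm_mult mult_left_le_one_le)
    have "(\<Sum>l=1..m. S l * (u (a + int l + 1) + u (a + int l - 1) - of_real (2 * cos \<theta>) * u (a + int l)))
      = (\<Sum>l=1..m. S l * f (a + int l))"
      by (rule sum.cong) (simp_all add: eq)
    then have "S (m + 1) * u (a + int m) = S m * u (a + int m + 1) + S 1 * u a - (\<Sum>l=1..m. S l * f (a + int l))"
      using sine_green_identity[where \<theta> = \<theta> and m = m and u = u and a = a] by (simp add: S_def)
    then have "cmod (S (m + 1) * u (a + int m))
      \<le> cmod (S m * u (a + int m + 1)) + cmod (S 1 * u a) + (\<Sum>l=1..m. cmod (S l * f (a + int l)))"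
      using norm_triangle_ineq4[of "S m * u (a + int m + 1) + S 1 * u a" "\<Sum>l=1..m. S l * f (a + int l)"]
        norm_triangle_ineq[of "S m * u (a + int m + 1)" "S 1 * u a"]
        norm_sum[of "\<lambda>l. S l * f (a + int l)" "{1..m}"] by simp
    also have "(\<Sum>l=1..m. cmod (S l * f (a + int l))) \<le> (\<Sum>l=1..m. cmod (f (a + int l)))"
      by (intro sum_mono S1)
    also have "cmod (S m * u (a + int m + 1)) + cmod (S 1 * u a) + (\<Sum>l=1..m. cmod (f (a + int l))) \<le> X"
      using X S1[of m "u (a + int m + 1)"] S1[of 1 "u a"] by linarith
    finally have "\<bar>sin (real (m + 1) * \<theta>)\<bar> * cmod (u (a + int m)) \<le> X"
      by (simp add: S_def norm_mult)
    moreover have "\<delta> * cmod (u (a + int m)) \<le> \<bar>sin (real (m + 1) * \<theta>)\<bar> * cmod (u (a + int m))"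
      using \<delta>(3) by (intro mult_right_mono) auto
    ultimately show ?thesis using \<delta>(1) by (simp add: field_simps)
  qed
  define Y where "Y = X / \<delta>"
  have Y: "Y \<ge> 0" unfolding Y_def using X0 \<delta> by simp
  have "cmod (u (a + int m - int j)) \<le> 4 ^ j * Y \<and> cmod (u (a + int m - int j + 1)) \<le> 4 ^ j * Y"
    using j
  proof (induction j)
    case 0
    then show ?case using last b by (simp add: Y_def)
  next
    case (Suc j)
    define n where "n = a + int m - int j"
    have IH: "cmod (u n) \<le> 4 ^ j * Y" "cmod (u (n + 1)) \<le> 4 ^ j * Y"
      using Suc by (auto simp: n_def)
    have mj: "m - j \<in> {1..m}" "n = a + int (m - j)" using Suc.prems by (auto simp: n_def)
    have "u (n - 1) = f n - u (n + 1) + of_real (2 * cos \<theta>) * u n"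
      using eq[OF mj(1)] unfolding mj(2)[symmetric] by simp
    then have "cmod (u (n - 1)) \<le> cmod (f n) + cmod (u (n + 1)) + cmod (of_real (2 * cos \<theta>) * u n)"
      using norm_triangle_ineq[of "f n - u (n + 1)" "of_real (2 * cos \<theta>) * u n"]
        norm_triangle_ineq4[of "f n" "u (n + 1)"] by simp
    also have "cmod (of_real (2 * cos \<theta>) * u n) \<le> 2 * cmod (u n)"
      by (simp add: norm_mult mult_left_le_one_le)
    also have "cmod (f n) \<le> Y" using fX[OF mj(1)] by (simp add: Y_def mj(2)[symmetric])
    also have "Y \<le> 4 ^ j * Y" using Y by (simp add: mult_le_cancel_right1)
    finally have "cmod (u (n - 1)) \<le> 4 ^ Suc j * Y" using IH by simp
    moreover have "4 ^ j * Y \<le> 4 ^ Suc j * Y" using Y by simp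
    ultimately show ?case using IH by (simp add: n_def algebra_simps)
  qed
  then show ?thesis by (simp add: Y_def)
qed

lemma run_endpoints:
  fixes \<omega> :: "int \<Rightarrow> nat"
  assumes no_run: "\<And>m. \<exists>n<K. \<omega> (m + int n) \<noteq> \<omega> m" and n: "\<omega> n = i"
  obtains p q where "1 \<le> p" "p \<le> K" "1 \<le> q" "q \<le> K" "\<omega> (n - int p) \<noteq> i" "\<omega> (n + int q) \<noteq> i"
    "\<And>l. n - int p < l \<Longrightarrow> l < n + int q \<Longrightarrow> \<omega> l = i"
proof -
  have q_ex: "\<exists>q. \<omega> (n + int q) \<noteq> i" "\<exists>q\<le>K. \<omega> (n + int q) \<noteq> i"
    using no_run[of n] n by (auto intro: less_imp_le)
  have "\<exists>p\<le>K. \<omega> (n - int p) \<noteq> i"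
  proof -
    obtain r where r: "r < K" "\<omega> (n - int K + int r) \<noteq> \<omega> (n - int K)"
      using no_run[of "n - int K"] by blast
    then have "\<omega> (n - int K) \<noteq> i \<or> \<omega> (n - int (K - r)) \<noteq> i"
      by (auto simp: of_nat_diff algebra_simps)
    then show ?thesis using diff_le_self by blast
  qed
  then obtain p0 where p0: "p0 \<le> K" "\<omega> (n - int p0) \<noteq> i" by blast
  obtain q0 where q0: "q0 \<le> K" "\<omega> (n + int q0) \<noteq> i" using q_ex by blast
  define p where "p = (LEAST p. \<omega> (n - int p) \<noteq> i)"
  define q where "q = (LEAST q. \<omega> (n + int q) \<noteq> i)"
  have p: "\<omega> (n - int p) \<noteq> i" "p \<le> p0" "\<And>p'. p' < p \<Longrightarrow> \<omega> (n - int p') = i"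
    unfolding p_def
    by (fact LeastI[of "\<lambda>p. \<omega> (n - int p) \<noteq> i", OF p0(2)]
        Least_le[of "\<lambda>p. \<omega> (n - int p) \<noteq> i", OF p0(2)])+
      (use not_less_Least in blast)
  have q: "\<omega> (n + int q) \<noteq> i" "q \<le> q0" "\<And>q'. q' < q \<Longrightarrow> \<omega> (n + int q') = i"
    unfolding q_def
    by (fact LeastI[of "\<lambda>q. \<omega> (n + int q) \<noteq> i", OF q0(2)]
        Least_le[of "\<lambda>q. \<omega> (n + int q) \<noteq> i", OF q0(2)])+
      (use not_less_Least in blast)
  have "p \<noteq> 0" using p(1) n by (cases "p = 0") auto
  moreover have "q \<noteq> 0" using q(1) n by (cases "q = 0") auto
  moreover have "\<omega> l = i" if "n - int p < l" "l < n + int q" for l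
  proof (cases "l \<le> n")
    case True
    then show ?thesis using p(3)[of "nat (n - l)"] that by auto
  next
    case False
    then show ?thesis using q(3)[of "nat (l - n)"] that by auto
  qed
  ultimately show ?thesis using that[of p q] p q p0 q0 by auto
qed

text \<open>Split \<open>u\<close> into its part \<open>P\<close> on the sites with letter \<open>i\<close> and its part \<open>Q\<close> on the barriers, and
  let \<open>g\<close> be the image of \<open>u\<close>. The barriers give \<open>(\<Delta> - 2) \<parallel>Q\<parallel> \<le> \<parallel>g\<parallel> + 2 \<parallel>u\<parallel>\<close>, and the runs give
  \<open>\<parallel>P\<parallel> \<le> (D / \<delta>) (\<parallel>Q\<parallel> + \<parallel>g\<parallel>)\<close>, where \<open>D\<close> collects the loss \<open>4 ^ (2 K)\<close> along a run and the
  \<open>2 K + 1\<close> translates in a window that contains the run and its two ends. Thus \<open>\<parallel>u\<parallel>\<close> reappears on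
  the right with coefficient at most \<open>4 D / (\<delta> (\<Delta> - 2))\<close>, and \<open>\<delta>\<close> is chosen to make it \<open>1 / 2\<close>;
  the lower bound on \<open>\<Delta>\<close> ensures \<open>\<delta> \<le> 1\<close>.\<close>

lemma near_level_bounded_below:
  fixes \<omega> :: "int \<Rightarrow> nat" and v :: "nat \<Rightarrow> real" and D \<delta> \<Delta> \<theta> :: real
  assumes no_run: "\<And>m. \<exists>n<K. \<omega> (m + int n) \<noteq> \<omega> m"
    and range: "\<And>n. \<omega> n \<in> {1..k}"
    and gap: "\<And>l. l \<in> {1..k} \<Longrightarrow> l \<noteq> i \<Longrightarrow> \<Delta> \<le> \<bar>v l - v i\<bar>"
    and D: "D = 4 ^ (2 * K) * (2 * K + 1)"
    and \<Delta>: "\<Delta> \<ge> 8 * D + 2" and \<delta>: "\<delta> = 8 * D / (\<Delta> - 2)"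
    and nonres: "\<And>m. m \<le> 2 * K \<Longrightarrow> \<delta> \<le> \<bar>sin (real (m + 1) * \<theta>)\<bar>"
  shows "bounded_below (jacobi (\<lambda>n. complex_of_real (v (\<omega> n)) - of_real (v i + 2 * cos \<theta>)))"
proof -
  have D1: "D \<ge> 1" unfolding D using mult_mono[of 1 "4 ^ (2 * K) :: real" 1 "2 * real K + 1"] by (simp add: algebra_simps)
  have \<Delta>2: "\<Delta> - 2 > 0" using \<Delta> D1 by linarith
  have "0 < \<delta>" unfolding \<delta> using D1 \<Delta>2 by (intro divide_pos_pos) auto
  moreover have "\<delta> \<le> 1" unfolding \<delta> using \<Delta> \<Delta>2 by (simp add: divide_le_eq)
  ultimately have \<delta>01: "0 < \<delta>" "\<delta> \<le> 1" by auto
  define E where "E = v i + 2 * cos \<theta>"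
  define A where "A = jacobi (\<lambda>n. complex_of_real (v (\<omega> n)) - of_real E)"
  have "\<delta> / (4 * D) * ell2_norm u \<le> ell2_norm (A u)" if u: "u \<in> ell2" for u
  proof -
    define g where "g = A u"
    have g: "g \<in> ell2"
      unfolding g_def A_def
      using jacobi_bounded(1)[where q = "\<lambda>n. complex_of_real (v (\<omega> n)) - of_real E",
        OF potential_bounded[where \<omega> = \<omega> and k = k, OF range] u] .
    define Q where "Q = (\<lambda>n. if \<omega> n = i then 0 else u n)"
    define P where "P = (\<lambda>n. if \<omega> n = i then u n else 0)"
    have Q: "Q \<in> ell2" and P: "P \<in> ell2"
      using ell2_dominated(1)[OF u, of Q] ell2_dominated(1)[OF u, of P] by (auto simp: Q_def P_def)
    have uPQ: "ell2_norm u \<le> ell2_norm P + ell2_norm Q"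
    proof -
      have "(\<lambda>n. P n + Q n) = u" by (auto simp: P_def Q_def)
      with ell2_add(2)[OF P Q] show ?thesis by simp
    qed
    define a where "a w = (\<lambda>n. complex_of_real (cmod (w n)))" for w :: "int \<Rightarrow> complex"
    have a: "a w \<in> ell2" "ell2_norm (a w) \<le> ell2_norm w" if "w \<in> ell2" for w
      using ell2_cmod[OF that] by (auto simp: a_def)
    have Qbd: "(\<Delta> - 2) * ell2_norm Q \<le> ell2_norm g + 2 * ell2_norm u"
    proof -
      define h where "h = (\<lambda>n. a g n + (a u (n + 1) + a u (n - 1)))"
      note s1 = ell2_shift[OF a(1)[OF u], of 1] and s2 = ell2_shift[OF a(1)[OF u], of "- 1"]
      note s3 = ell2_add[OF s1(1) s2(1)]
      note s4 = ell2_add[OF a(1)[OF g] s3(1)]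
      have h: "h \<in> ell2" "ell2_norm h \<le> ell2_norm g + 2 * ell2_norm u"
        using s1(2) s2(2) s3(2) s4 a(2)[OF u] a(2)[OF g] by (auto simp: h_def)
      have "(\<Delta> - 2) * cmod (Q n) \<le> cmod (h n)" for n
      proof (cases "\<omega> n = i")
        case False
        have "\<bar>v (\<omega> n) - E\<bar> \<ge> \<Delta> - 2"
          using gap[OF range False] abs_cos_le_one[of \<theta>] unfolding E_def by linarith
        then have "(\<Delta> - 2) * cmod (u n) \<le> cmod ((complex_of_real (v (\<omega> n)) - of_real E) * u n)"
          unfolding norm_mult by (intro mult_right_mono) (auto simp flip: of_real_diff)
        also have "(complex_of_real (v (\<omega> n)) - of_real E) * u n = g n - (u (n + 1) + u (n - 1))"
          by (simp add: g_def A_def jacobi_def)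
        also have "cmod \<dots> \<le> cmod (g n) + (cmod (u (n + 1)) + cmod (u (n - 1)))"
          using norm_triangle_ineq4[of "g n" "u (n + 1) + u (n - 1)"]
            norm_triangle_ineq[of "u (n + 1)" "u (n - 1)"] by linarith
        also have "\<dots> = cmod (h n)"
        proof -
          have "h n = of_real (cmod (g n) + (cmod (u (n + 1)) + cmod (u (n - 1))))"
            by (simp add: h_def a_def)
          then show ?thesis by (simp only: norm_of_real) simp
        qed
        finally show ?thesis using False \<Delta>2 by (simp add: Q_def)
      qed (simp add: Q_def)
      from ell2_dominated_scaled(2)[OF h(1) \<Delta>2 this] h(2) show ?thesis by linarith
    qed
    have Pbd: "ell2_norm P \<le> D / \<delta> * (ell2_norm Q + ell2_norm g)"
    proof -
      \<comment> \<open>a translation-invariant majorant: each window of radius \<open>K\<close> contains the run and both its ends\<close>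
      define h where "h = (\<lambda>n. \<Sum>j=-int K..int K. a Q (n + j) + a g (n + j))"
      have hj: "(\<lambda>n. a Q (n + j) + a g (n + j)) \<in> ell2"
        "ell2_norm (\<lambda>n. a Q (n + j) + a g (n + j)) \<le> ell2_norm Q + ell2_norm g" for j
        using ell2_add[OF ell2_shift(1)[OF a(1)[OF Q], of j] ell2_shift(1)[OF a(1)[OF g], of j]]
          ell2_shift(2)[OF a(1)[OF Q], of j] ell2_shift(2)[OF a(1)[OF g], of j] a(2)[OF Q] a(2)[OF g] by auto
      have "h \<in> ell2 \<and> ell2_norm h \<le> (\<Sum>j=-int K..int K. ell2_norm Q + ell2_norm g)"
        unfolding h_def by (rule ell2_sum) (simp_all add: hj)
      then have h: "h \<in> ell2" "ell2_norm h \<le> (2 * K + 1) * (ell2_norm Q + ell2_norm g)"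
        by (auto simp: algebra_simps)
      define c where "c = 4 ^ (2 * K) / \<delta>"
      have c: "c > 0" using \<delta>01 by (simp add: c_def)
      have "cmod (P n) \<le> cmod (of_real c * h n)" for n
      proof (cases "\<omega> n = i")
        case True
        obtain p q where pq: "1 \<le> p" "p \<le> K" "1 \<le> q" "q \<le> K" "\<omega> (n - int p) \<noteq> i" "\<omega> (n + int q) \<noteq> i"
          "\<And>l. n - int p < l \<Longrightarrow> l < n + int q \<Longrightarrow> \<omega> l = i"
          using run_endpoints[where \<omega> = \<omega> and K = K, OF no_run True] by metis
        \<comment> \<open>the run is \<open>b + 1, \<dots>, b + m\<close>; the barriers at its ends are \<open>b\<close> and \<open>b + m + 1\<close>\<close>
        define m where "m = p + q - 1"
        define b where "b = n - int p"
        define H where "H j = cmod (Q (n + j)) + cmod (g (n + j))" for j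
        define X where "X = (\<Sum>j=-int K..int K. H j)"
        have H0: "H j \<ge> 0" for j by (simp add: H_def)
        have bm: "b + int m + 1 = n + int q" using pq by (simp add: b_def m_def of_nat_diff)
        have "cmod (u b) + cmod (u (b + int m + 1)) + (\<Sum>l=1..m. cmod (g (b + int l))) \<le> X"
        proof -
          have 1: "cmod (u b) \<le> H (- int p)" "cmod (u (b + int m + 1)) \<le> H (int q)"
            using pq unfolding bm by (simp_all add: H_def Q_def b_def)
          have "(\<Sum>l=1..m. cmod (g (b + int l))) \<le> (\<Sum>l=1..m. H (int l - int p))"
            by (intro sum_mono) (simp add: H_def b_def algebra_simps)
          also have "\<dots> = (\<Sum>j\<in>(\<lambda>l. int l - int p) ` {1..m}. H j)"
            by (subst sum.reindex) (auto simp: inj_on_def)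
          finally have "cmod (u b) + cmod (u (b + int m + 1)) + (\<Sum>l=1..m. cmod (g (b + int l)))
            \<le> (\<Sum>j\<in>{- int p}. H j) + (\<Sum>j\<in>{int q}. H j) + (\<Sum>j\<in>(\<lambda>l. int l - int p) ` {1..m}. H j)"
            using 1 by simp
          also have "\<dots> = (\<Sum>j\<in>{- int p} \<union> {int q}. H j) + (\<Sum>j\<in>(\<lambda>l. int l - int p) ` {1..m}. H j)"
            using pq by (subst sum.union_disjoint) auto
          also have "\<dots> = (\<Sum>j\<in>({- int p} \<union> {int q}) \<union> (\<lambda>l. int l - int p) ` {1..m}. H j)"
            using pq by (subst (2) sum.union_disjoint) (auto simp: m_def of_nat_diff)
          also have "\<dots> \<le> X"
            unfolding X_def using pq H0 by (intro sum_mono2) (auto simp: m_def of_nat_diff)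
          finally show ?thesis .
        qed
        moreover have "g (b + int l) = u (b + int l + 1) + u (b + int l - 1) - of_real (2 * cos \<theta>) * u (b + int l)"
          if "l \<in> {1..m}" for l
        proof -
          have "\<omega> (b + int l) = i" using that pq by (intro pq(7)) (auto simp: b_def m_def)
          then show ?thesis by (simp add: g_def A_def jacobi_def E_def algebra_simps)
        qed
        moreover have "\<delta> \<le> \<bar>sin (real (m + 1) * \<theta>)\<bar>" using pq by (intro nonres) (auto simp: m_def)
        moreover have "q - 1 \<le> m" using pq by (auto simp: m_def)
        ultimately have "cmod (u (b + int m - int (q - 1))) \<le> 4 ^ (q - 1) * X / \<delta>"
          using run_bound[of m g b u \<theta> \<delta> X "q - 1"] \<delta>01 by blast
        moreover have "b + int m - int (q - 1) = n" using pq by (simp add: b_def m_def of_nat_diff)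
        moreover have "4 ^ (q - 1) * X / \<delta> \<le> c * X"
        proof -
          have "X \<ge> 0" unfolding X_def using H0 by (intro sum_nonneg) auto
          moreover have "(4::real) ^ (q - 1) \<le> 4 ^ (2 * K)" using pq by (intro power_increasing) auto
          ultimately show ?thesis using \<delta>01 by (simp add: c_def divide_right_mono mult_right_mono)
        qed
        ultimately have "cmod (u n) \<le> c * X" by simp
        moreover have "h n = of_real X" by (simp add: h_def X_def H_def a_def)
        moreover have "X \<ge> 0" unfolding X_def using H0 by (intro sum_nonneg) auto
        ultimately show ?thesis using True c by (simp add: P_def norm_mult)
      qed (simp add: P_def)
      from ell2_dominated(2)[OF ell2_cmult(1)[OF h(1)] this]
      have "ell2_norm P \<le> ell2_norm (\<lambda>n. of_real c * h n)" .
      also have "\<dots> \<le> c * ell2_norm h" using ell2_cmult(2)[OF h(1), of "of_real c"] c by simp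
      also have "\<dots> \<le> c * ((2 * K + 1) * (ell2_norm Q + ell2_norm g))"
        using h(2) c by (intro mult_left_mono) auto
      also have "\<dots> = D / \<delta> * (ell2_norm Q + ell2_norm g)" by (simp add: c_def D algebra_simps add_divide_distrib)
      finally show ?thesis .
    qed
    define x where "x = ell2_norm u"
    define y where "y = ell2_norm g"
    define z where "z = ell2_norm Q"
    define r where "r = D / \<delta>"
    have z0: "z \<ge> 0" "y \<ge> 0" by (simp_all add: z_def y_def ell2_norm_nonneg)
    have r1: "r \<ge> 1" unfolding r_def using D1 \<delta>01 by (simp add: field_simps)
    have lr: "\<Delta> - 2 = 8 * r" unfolding r_def \<delta> using \<Delta>2 D1 by simp
    have "x \<le> r * (z + y) + z" using uPQ Pbd by (simp add: x_def y_def z_def r_def)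
    also have "\<dots> \<le> 2 * r * z + r * y"
      using mult_right_mono[OF r1 z0(1)] by (simp add: algebra_simps)
    finally have "x \<le> 2 * (r * z) + r * y" by simp
    moreover have "8 * (r * z) \<le> y + 2 * x" using Qbd unfolding lr by (simp add: x_def y_def z_def)
    moreover have "y \<le> r * y" using mult_right_mono[OF r1 z0(2)] by simp
    ultimately have "x \<le> 4 * (r * y)" using z0(2) by linarith
    moreover have "\<delta> / (4 * D) * (4 * (r * y)) = y"
      using \<delta>01 D1 by (simp add: r_def)
    moreover have "\<delta> / (4 * D) \<ge> 0" using \<delta>01 D1 by simp
    ultimately have "\<delta> / (4 * D) * x \<le> y" by (metis mult_left_mono)
    then show ?thesis by (simp add: x_def y_def g_def)
  qed
  moreover have "\<delta> / (4 * D) > 0" using \<delta>01 D1 by simp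
  ultimately show ?thesis unfolding bounded_below_def A_def E_def by blast
qed

section \<open>Localization of the spectrum\<close>

text \<open>The diagonal part is at least \<open>d > 2\<close> in modulus, and the two hopping terms have norm at most 2
  together.\<close>

lemma far_from_levels_bounded_below:
  fixes \<omega> :: "int \<Rightarrow> nat" and v :: "nat \<Rightarrow> real"
  assumes range: "\<And>n. \<omega> n \<in> {1..k}"
    and far: "\<And>i. i \<in> {1..k} \<Longrightarrow> 2 < \<bar>v i - x\<bar>"
  shows "bounded_below (jacobi (\<lambda>n. complex_of_real (v (\<omega> n)) - of_real x))"
proof -
  define d where "d = Min ((\<lambda>i. \<bar>v i - x\<bar>) ` {1..k})"
  have ne: "{1..k} \<noteq> {}" using range[of 0] by auto
  have d: "d > 2" "\<And>i. i \<in> {1..k} \<Longrightarrow> d \<le> \<bar>v i - x\<bar>"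
    using far ne unfolding d_def by (auto simp: Min_gr_iff)
  have "(d - 2) * ell2_norm u \<le> ell2_norm (jacobi (\<lambda>n. complex_of_real (v (\<omega> n)) - of_real x) u)"
    if u: "u \<in> ell2" for u
  proof -
    define g where "g = jacobi (\<lambda>n. complex_of_real (v (\<omega> n)) - of_real x) u"
    have g: "g \<in> ell2"
      unfolding g_def
      using jacobi_bounded(1)[where q = "\<lambda>n. complex_of_real (v (\<omega> n)) - of_real x",
        OF potential_bounded[where \<omega> = \<omega> and k = k, OF range] u] .
    define h where "h = (\<lambda>n. g n - (u (n + 1) + u (n - 1)))"
    note s1 = ell2_shift[OF u, of 1] and s2 = ell2_shift[OF u, of "- 1"]
    note s3 = ell2_add[OF s1(1) s2(1)]
    note s4 = ell2_diff[OF g s3(1)]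
    have h: "h \<in> ell2" "ell2_norm h \<le> ell2_norm g + 2 * ell2_norm u"
      using s1(2) s2(2) s3(2) s4 by (auto simp: h_def)
    have "d * cmod (u n) \<le> cmod (h n)" for n
    proof -
      have "h n = of_real (v (\<omega> n) - x) * u n" by (simp add: h_def g_def jacobi_def)
      then have "cmod (h n) = \<bar>v (\<omega> n) - x\<bar> * cmod (u n)" by (simp only: norm_mult norm_of_real)
      then show ?thesis using d(2)[OF range[of n]] by (simp add: mult_right_mono)
    qed
    from ell2_dominated_scaled(2)[OF h(1) _ this] d(1) h(2)
    have "d * ell2_norm u \<le> ell2_norm g + 2 * ell2_norm u" by linarith
    then show ?thesis by (simp add: g_def algebra_simps)
  qed
  moreover have "d - 2 > 0" using d by simp
  ultimately show ?thesis unfolding bounded_below_def by blast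
qed

lemma abs_sin_ge_third:
  fixes y :: real
  assumes "\<bar>y\<bar> \<le> 2"
  shows "\<bar>y\<bar> \<le> 3 * \<bar>sin y\<bar>"
proof -
  have "\<bar>sin y - (\<Sum>m<3. sin_coeff m * y ^ m)\<bar> \<le> inverse (fact 3) * \<bar>y\<bar> ^ 3"
    by (rule Maclaurin_sin_bound)
  then have "\<bar>sin y - y\<bar> \<le> \<bar>y\<bar> ^ 3 / 6"
    by (simp add: eval_nat_numeral sin_coeff_def)
  moreover have "\<bar>y\<bar> ^ 3 \<le> 4 * \<bar>y\<bar>"
  proof -
    have "\<bar>y\<bar> ^ 2 \<le> 2 ^ 2" using assms by (intro power_mono) auto
    from mult_right_mono[OF this, of "\<bar>y\<bar>"] show ?thesis by (simp add: eval_nat_numeral)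
  qed
  ultimately show ?thesis by linarith
qed

lemma abs_cos_diff_le: "\<bar>cos x - cos y\<bar> \<le> \<bar>x - y :: real\<bar>"
proof -
  have "\<bar>cos x - cos y\<bar> = 2 * (\<bar>sin ((x + y) / 2)\<bar> * \<bar>sin ((y - x) / 2)\<bar>)"
    by (simp add: cos_diff_cos abs_mult)
  also have "\<dots> \<le> 2 * (1 * \<bar>(y - x) / 2\<bar>)"
    by (intro mult_left_mono mult_mono abs_sin_x_le_abs_x) auto
  finally show ?thesis by simp
qed

text \<open>The zero of \<open>sin\<close> nearest to \<open>M \<theta>\<close> is at distance less than 2, where \<open>\<bar>sin\<bar>\<close> controls the distance
  up to a factor 3; \<open>2 * cos\<close> contributes another factor 2.\<close>

lemma near_zero_of_sin_multiple:
  fixes \<theta> \<delta> :: real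
  assumes \<theta>: "0 \<le> \<theta>" "\<theta> \<le> pi" and M: "M \<ge> 1" and small: "\<bar>sin (real M * \<theta>)\<bar> < \<delta>"
  shows "\<exists>j\<le>M. \<bar>2 * cos \<theta> - 2 * cos (pi * real j / real M)\<bar> \<le> 6 * \<delta>"
proof -
  define t where "t = real M * \<theta> / pi"
  have t: "0 \<le> t" "t \<le> real M" using \<theta> by (auto simp: t_def field_simps mult_right_mono)
  define j where "j = nat (round t)"
  have "round t \<ge> round 0" "round t \<le> round (real M)"
    using round_mono[OF t(1)] round_mono[OF t(2)] by auto
  then have j: "real j = of_int (round t)" "j \<le> M" by (auto simp: j_def)
  define y where "y = real M * \<theta> - real j * pi"
  have "\<bar>of_int (round t) - t\<bar> \<le> 1 / 2" by (rule of_int_round_abs_le)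
  then have "\<bar>pi * (t - real j)\<bar> \<le> pi * (1 / 2)"
    unfolding abs_mult j(1) by (simp add: abs_minus_commute)
  moreover have "pi * (t - real j) = y" by (simp add: y_def t_def algebra_simps)
  ultimately have "\<bar>y\<bar> \<le> 2" using pi_less_4 by linarith
  then have "\<bar>y\<bar> \<le> 3 * \<bar>sin y\<bar>" by (rule abs_sin_ge_third)
  also have "\<bar>sin y\<bar> = \<bar>sin (real M * \<theta>)\<bar>"
    by (simp add: y_def sin_diff sin_npi cos_npi abs_mult power_abs)
  finally have y: "\<bar>y\<bar> \<le> 3 * \<delta>" using small by linarith
  have "\<bar>2 * cos \<theta> - 2 * cos (pi * real j / real M)\<bar> = 2 * \<bar>cos \<theta> - cos (pi * real j / real M)\<bar>"
    by (simp only: right_diff_distrib[symmetric] abs_mult abs_numeral)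
  also have "\<dots> \<le> 2 * \<bar>\<theta> - pi * real j / real M\<bar>"
    by (intro mult_left_mono abs_cos_diff_le) auto
  also have "\<theta> - pi * real j / real M = y / real M" using M by (simp add: y_def field_simps)
  also have "\<bar>y / real M\<bar> \<le> \<bar>y\<bar>" using M by (simp add: abs_divide divide_le_eq mult_le_cancel_left1)
  finally show ?thesis using y j(2) by (intro exI[of _ j]) linarith
qed

lemma spectrum_near_levels:
  fixes \<omega> :: "int \<Rightarrow> nat"
  assumes "\<And>n. \<omega> n \<in> {1..k}" "complex_of_real x \<in> spectrum_ell2 (schrodinger v \<omega>)"
  shows "\<exists>i\<in>{1..k}. \<bar>x - v i\<bar> \<le> 2"
proof (rule ccontr)
  assume "\<not> ?thesis"
  then have "bounded_below (jacobi (\<lambda>n. complex_of_real (v (\<omega> n)) - of_real x))"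
    by (intro far_from_levels_bounded_below[where k = k] assms(1)) (auto simp: not_le abs_minus_commute)
  then show False
    using assms(2) schrodinger_spectrum_iff[where \<omega> = \<omega> and k = k, OF assms(1)] by blast
qed

text \<open>The centres \<open>2 * cos (\<pi> j / (m + 1))\<close> with \<open>1 \<le> j \<le> m\<close> are the eigenvalues of the free block of
  length \<open>m\<close>. The values \<open>j = 0\<close> and \<open>j = m + 1\<close> come from the zeros of \<open>sin ((m + 1) \<theta>)\<close> at \<open>\<theta> = 0\<close> and
  \<open>\<theta> = \<pi>\<close>.\<close>

lemma spectrum_near_block_eigenvalues:
  fixes \<omega> :: "int \<Rightarrow> nat" and v :: "nat \<Rightarrow> real" and D \<Delta> :: real
  assumes no_run: "\<And>m. \<exists>n<K. \<omega> (m + int n) \<noteq> \<omega> m"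
    and range: "\<And>n. \<omega> n \<in> {1..k}"
    and gap: "\<And>i j. i \<in> {1..k} \<Longrightarrow> j \<in> {1..k} \<Longrightarrow> i \<noteq> j \<Longrightarrow> \<Delta> \<le> \<bar>v i - v j\<bar>"
    and D: "D = 4 ^ (2 * K) * (2 * K + 1)" and \<Delta>: "\<Delta> \<ge> 8 * D + 2"
    and spec: "complex_of_real x \<in> spectrum_ell2 (schrodinger v \<omega>)"
  shows "\<exists>i\<in>{1..k}. \<exists>m\<le>2 * K. \<exists>j\<le>m + 1.
    \<bar>x - (v i + 2 * cos (pi * real j / real (m + 1)))\<bar> \<le> 6 * (8 * D / (\<Delta> - 2))"
proof -
  obtain i where i: "i \<in> {1..k}" "\<bar>x - v i\<bar> \<le> 2" using spectrum_near_levels[OF range spec] by blast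
  define \<theta> where "\<theta> = arccos ((x - v i) / 2)"
  have "- 1 \<le> (x - v i) / 2" "(x - v i) / 2 \<le> 1" using i(2) by auto
  then have \<theta>01: "0 \<le> \<theta>" "\<theta> \<le> pi" "cos \<theta> = (x - v i) / 2"
    unfolding \<theta>_def by (simp_all add: arccos_lbound arccos_ubound)
  then have \<theta>: "0 \<le> \<theta>" "\<theta> \<le> pi" "x = v i + 2 * cos \<theta>"
    by auto
  have "\<not> bounded_below (jacobi (\<lambda>n. complex_of_real (v (\<omega> n)) - of_real (v i + 2 * cos \<theta>)))"
    using spec schrodinger_spectrum_iff[where \<omega> = \<omega> and k = k, OF range] unfolding \<theta>(3) by blast
  then have "\<not> (\<forall>m\<le>2 * K. 8 * D / (\<Delta> - 2) \<le> \<bar>sin (real (m + 1) * \<theta>)\<bar>)"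
    using near_level_bounded_below[where \<omega> = \<omega> and K = K and v = v and i = i and \<theta> = \<theta>,
        OF no_run range gap[OF _ i(1)] D \<Delta> refl] by blast
  then obtain m where m: "m \<le> 2 * K" "\<bar>sin (real (m + 1) * \<theta>)\<bar> < 8 * D / (\<Delta> - 2)"
    by (auto simp: not_le)
  obtain j where "j \<le> m + 1" "\<bar>2 * cos \<theta> - 2 * cos (pi * real j / real (m + 1))\<bar> \<le> 6 * (8 * D / (\<Delta> - 2))"
    using near_zero_of_sin_multiple[where M = "m + 1", OF \<theta>(1,2) _ m(2)] by (metis le_add2)
  then show ?thesis using i(1) m(1) unfolding \<theta>(3) by (intro bexI[of _ i] exI[of _ m] exI[of _ j] conjI) auto
qed

section \<open>The measure of the spectrum\<close>

lemma emeasure_le_of_cover_by_intervals: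
  fixes S :: "real set"
  assumes "finite I" "r \<ge> 0" "\<And>x. x \<in> S \<Longrightarrow> \<exists>i\<in>I. \<bar>x - c i\<bar> \<le> r"
  shows "emeasure lborel S \<le> ennreal (real (card I) * (2 * r))"
proof -
  have "S \<subseteq> (\<Union>i\<in>I. {c i - r..c i + r})"
  proof
    fix x assume "x \<in> S"
    then obtain i where "i \<in> I" "\<bar>x - c i\<bar> \<le> r" using assms(3) by blast
    then show "x \<in> (\<Union>i\<in>I. {c i - r..c i + r})" by (auto intro!: bexI[of _ i])
  qed
  then have "emeasure lborel S \<le> emeasure lborel (\<Union>i\<in>I. {c i - r..c i + r})"
    using assms(1) by (intro emeasure_mono) auto
  also have "\<dots> \<le> (\<Sum>i\<in>I. emeasure lborel {c i - r..c i + r})"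
    using assms(1) by (intro emeasure_subadditive_finite) auto
  also have "\<dots> = (\<Sum>i\<in>I. ennreal (2 * r))"
    using assms(2) by (intro sum.cong) auto
  also have "\<dots> = ennreal (real (card I) * (2 * r))"
    using assms(2) by (simp add: ennreal_mult ennreal_of_nat_eq_real_of_nat)
  finally show ?thesis .
qed

lemma min_gap_le:
  assumes "i \<in> {1..k}" "j \<in> {1..k}" "i \<noteq> j"
  shows "min_gap k v \<le> \<bar>v i - v j\<bar>"
proof -
  define G where "G = {\<bar>v i - v j\<bar> | i j. 1 \<le> i \<and> i < j \<and> j \<le> k}"
  have "G \<subseteq> (\<lambda>(i, j). \<bar>v i - v j\<bar>) ` ({1..k} \<times> {1..k})" unfolding G_def by force
  then have fin: "finite G" by (rule finite_subset) auto
  have "\<bar>v i - v j\<bar> \<in> G"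
    using assms unfolding G_def by (cases "i < j") (fastforce simp: abs_minus_commute)+
  with fin show ?thesis unfolding min_gap_def G_def[symmetric] by simp
qed

lemma min_gap_nonneg:
  assumes "k \<ge> 2"
  shows "min_gap k v \<ge> 0"
proof -
  define G where "G = {\<bar>v i - v j\<bar> | i j. 1 \<le> i \<and> i < j \<and> j \<le> k}"
  have "G \<subseteq> (\<lambda>(i, j). \<bar>v i - v j\<bar>) ` ({1..k} \<times> {1..k})" unfolding G_def by force
  then have fin: "finite G" by (rule finite_subset) auto
  have "\<bar>v 1 - v 2\<bar> \<in> G" using assms unfolding G_def by fastforce
  then have "Min G \<in> G" using fin by (intro Min_in) auto
  then show ?thesis unfolding min_gap_def G_def[symmetric] by (auto simp: G_def)
qed

theorem theorem3:
  fixes k :: nat and \<Omega> :: "(int \<Rightarrow> nat) set" and \<mu> :: "(int \<Rightarrow> nat) measure"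
  assumes "k \<ge> 2"
    and "subshift k \<Omega>"
    and "aperiodic \<Omega>"
    and "sets \<mu> = sets (restrict_space borel \<Omega>)"
    and "prob_space \<mu>"
    and "shift_invariant \<mu>"
    and "shift_ergodic \<mu>"
    and "\<exists>K::nat. K > 0 \<and> emeasure \<mu> {\<omega> \<in> \<Omega>. \<forall>n<K. \<omega> (int n) = \<omega> 0} = 0"
    and "\<exists>L::nat. L > 0 \<and> (\<forall>i\<in>{1..k}. \<forall>\<omega>\<in>msupport \<mu>. \<exists>j\<in>{0..L - 1}. \<omega> (int j) = i)"
  shows "\<forall>\<gamma>::real. 0 < \<gamma> \<and> \<gamma> < 1/4 \<longrightarrow>
    (\<exists>C::real. C > 0 \<and> (\<forall>v::nat \<Rightarrow> real.
      (\<exists>i\<in>{1..k}. \<exists>j\<in>{1..k}. v i \<noteq> v j) \<longrightarrow>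
      emeasure lborel {x::real. complex_of_real x \<in> as_spectrum \<mu> v}
        < (if min_gap k v = 0 then \<infinity> else ennreal (C * min_gap k v powr (- \<gamma>)))))"
proof (intro allI impI)
  fix \<gamma> :: real assume \<gamma>: "0 < \<gamma> \<and> \<gamma> < 1/4"
  obtain K where K: "emeasure \<mu> {\<omega> \<in> \<Omega>. \<forall>n<K. \<omega> (int n) = \<omega> 0} = 0" using assms(8) by blast
  obtain \<omega>\<^sub>0 where range: "\<And>n. \<omega>\<^sub>0 n \<in> {1..k}" and no_run: "\<And>m. \<exists>n<K. \<omega>\<^sub>0 (m + int n) \<noteq> \<omega>\<^sub>0 m"
    and spec: "\<And>v. as_spectrum \<mu> v = spectrum_ell2 (schrodinger v \<omega>\<^sub>0)"
    using as_spectrum_realized[OF assms(2,4-7) K] by blast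
  define D :: real where "D = 4 ^ (2 * K) * (2 * K + 1)"
  define N where "N = k * (2 * K + 1) * (2 * K + 2)"
  \<comment> \<open>the first two summands serve small and large gaps; the last makes the inequality strict\<close>
  define C where "C = 4 * k * (8 * D + 2) + 192 * D * N + 1"
  have D1: "D \<ge> 1" unfolding D_def using mult_mono[of 1 "4 ^ (2 * K) :: real" 1 "2 * real K + 1"] by (simp add: algebra_simps)
  have C: "C \<ge> 1" "4 * k * (8 * D + 2) < C" "192 * D * N < C"
    unfolding C_def using D1 assms(1) by (auto simp: add_pos_nonneg add_nonneg_pos)
  have "emeasure lborel {x::real. complex_of_real x \<in> as_spectrum \<mu> v}
      < (if min_gap k v = 0 then \<infinity> else ennreal (C * min_gap k v powr (- \<gamma>)))" for v
  proof -
    define S where "S = {x::real. complex_of_real x \<in> as_spectrum \<mu> v}"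
    define \<Delta> where "\<Delta> = min_gap k v"
    have \<Delta>0: "\<Delta> \<ge> 0" unfolding \<Delta>_def by (rule min_gap_nonneg[OF assms(1)])
    have "emeasure lborel S \<le> ennreal (real (card {1..k}) * (2 * 2))"
    proof (rule emeasure_le_of_cover_by_intervals)
      show "\<exists>i\<in>{1..k}. \<bar>x - v i\<bar> \<le> 2" if "x \<in> S" for x
        using that spectrum_near_levels[where \<omega> = \<omega>\<^sub>0, OF range] by (simp add: S_def spec)
    qed auto
    then have bands: "emeasure lborel S \<le> ennreal (4 * k)" by (simp add: mult.commute)
    have "emeasure lborel S < ennreal (C * \<Delta> powr - \<gamma>)" if \<Delta>: "\<Delta> > 0"
    proof (cases "\<Delta> < 8 * D + 2")
      case True
      \<comment> \<open>the spectrum has measure at most \<open>4 k\<close>, and \<open>\<Delta> powr - \<gamma>\<close> is at least \<open>1 / (8 D + 2)\<close>\<close>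
      have "(8 * D + 2) powr - 1 \<le> (8 * D + 2) powr - \<gamma>"
        using \<gamma> D1 by (intro powr_mono) auto
      also have "\<dots> \<le> \<Delta> powr - \<gamma>"
        using True \<Delta> \<gamma> by (intro powr_mono2') auto
      finally have "1 / (8 * D + 2) \<le> \<Delta> powr - \<gamma>"
        using D1 by (simp add: powr_minus_divide)
      then have "1 \<le> (8 * D + 2) * \<Delta> powr - \<gamma>" using D1 by (simp add: field_simps)
      then have "4 * real k * 1 \<le> 4 * real k * ((8 * D + 2) * \<Delta> powr - \<gamma>)"
        by (intro mult_left_mono) auto
      also have "\<dots> < C * \<Delta> powr - \<gamma>"
        using mult_strict_right_mono[OF C(2), of "\<Delta> powr - \<gamma>"] \<Delta> by (simp add: mult.assoc)
      finally show ?thesis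
        using C(1) \<Delta> by (intro le_less_trans[OF bands] ennreal_lessI) auto
    next
      case False
      define \<delta> where "\<delta> = 8 * D / (\<Delta> - 2)"
      define I where "I = {1..k} \<times> {..2 * K} \<times> {..2 * K + 1}"
      \<comment> \<open>\<open>\<Delta> \<ge> 4\<close>, so \<open>\<Delta> - 2\<close> is at least half of \<open>\<Delta>\<close>\<close>
      have \<delta>: "0 \<le> \<delta>" "\<delta> \<le> 16 * D / \<Delta>"
        using False D1 unfolding \<delta>_def by (auto simp: field_simps)
      have "card I = N" by (simp add: I_def N_def card_cartesian_product algebra_simps)
      have "emeasure lborel S \<le> ennreal (real (card I) * (2 * (6 * \<delta>)))"
      proof (rule emeasure_le_of_cover_by_intervals[where
            c = "\<lambda>(i, m, j). v i + 2 * cos (pi * real j / real (m + 1))"])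
        fix x assume "x \<in> S"
        then have "complex_of_real x \<in> spectrum_ell2 (schrodinger v \<omega>\<^sub>0)" by (simp add: S_def spec)
        from spectrum_near_block_eigenvalues[where K = K and k = k and \<Delta> = \<Delta>, OF no_run range _ D_def _ this]
        obtain i m j where "i \<in> {1..k}" "m \<le> 2 * K" "j \<le> m + 1"
          "\<bar>x - (v i + 2 * cos (pi * real j / real (m + 1)))\<bar> \<le> 6 * \<delta>"
          using min_gap_le[of _ k _ v] False unfolding \<delta>_def \<Delta>_def not_less by blast
        then show "\<exists>i\<in>I. \<bar>x - (case i of (i, m, j) \<Rightarrow> v i + 2 * cos (pi * real j / real (m + 1)))\<bar> \<le> 6 * \<delta>"
          unfolding I_def by (intro bexI[of _ "(i, m, j)"]) auto
      qed (use \<delta> in \<open>auto simp: I_def\<close>)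
      moreover have "real (card I) * (2 * (6 * \<delta>)) < C * \<Delta> powr - \<gamma>"
      proof -
        have "real N * (12 * \<delta>) \<le> real N * (12 * (16 * D / \<Delta>))"
          using \<delta> by (intro mult_left_mono) auto
        also have "\<dots> = 192 * D * N * (\<Delta> powr - 1)"
          using \<Delta> by (simp add: powr_minus_divide)
        also have "\<dots> \<le> 192 * D * N * (\<Delta> powr - \<gamma>)"
          using False D1 \<gamma> by (intro mult_left_mono powr_mono) auto
        also have "\<dots> < C * \<Delta> powr - \<gamma>"
          using C(3) \<Delta> by (intro mult_strict_right_mono) auto
        finally show ?thesis by (simp add: \<open>card I = N\<close>)
      qed
      ultimately show ?thesis
        using C(1) \<Delta> by (auto intro!: le_less_trans[of "emeasure lborel S"] ennreal_lessI)
    qed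
    moreover have "emeasure lborel S < \<infinity>" using bands by (simp add: le_less_trans)
    ultimately show ?thesis using \<Delta>0 unfolding S_def \<Delta>_def by auto
  qed
  with C(1) show "\<exists>C::real. C > 0 \<and> (\<forall>v::nat \<Rightarrow> real.
      (\<exists>i\<in>{1..k}. \<exists>j\<in>{1..k}. v i \<noteq> v j) \<longrightarrow>
      emeasure lborel {x::real. complex_of_real x \<in> as_spectrum \<mu> v}
        < (if min_gap k v = 0 then \<infinity> else ennreal (C * min_gap k v powr (- \<gamma>))))"
    by (intro exI[of _ C]) simp
qed

end
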